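(* The logic $\mathsf{Skvo}$ is strictly contained in $\mathsf{ML}$. In particular, there are finite sets of Wang tiles $\mathcal{W}_{i,j}$ ($i,j\in\{0,1\}$) such that $\mathcal{W}=\bigcup_{i,j}\mathcal{W}_{i,j}$ is aperiodic (i.e. there is a $\mathcal{W}$-tiling of the plane but no periodic $\mathcal{W}$-tiling), and such that the associated formula $\rho_{\mathcal{W}}:=\alpha(P_{\mathcal{W}},D_{\mathcal{W}})$ satisfies $\rho_{\mathcal{W}}\in\mathsf{ML}\setminus\mathsf{Skvo}$.
   Context: **Logics.** For a set $I$ let $M_I=(\mathcal{P}(I)\setminus\{\varnothing\},\supseteq)$, the poset of non-empty subsets of $I$ with $x\le y$ iff $x\supseteq y$. $\mathsf{ML}$ (resp. $\mathsf{Skvo}$) is the set of intuitionistic propositional formulas valid, in intuitionistic Kripke semantics, in $M_I$ for all finite sets $I$ (resp. for all sets $I$). **Tilings.** A Wang tile is a tuple $t=(t_W,t_E,t_N,t_S)\in\mathbb{N}^4$. For a finite tile set $\mathcal{W}$, a $\mathcal{W}$-tiling of the plane is a map $\tau:\mathbb{Z}\times\mathbb{Z}\to\mathcal{W}$ with $\tau(k,l)_E=\tau(k+1,l)_W$ and $\tau(k,l)_N=\tau(k,l+1)_S$ for all $k,l$. A periodic $\mathcal{W}$-tiling is a map $\tau:\mathbb{Z}_m\times\mathbb{Z}_n\to\mathcal{W}$, for some positive $m,n$, satisfying the same conditions with addition modulo $m$ and $n$ in the first and second coordinate. **Canonical formulas.** For a finite rooted poset $P$ with root $r$, $\mathrm{Up}(P)$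 is the Heyting algebra of its upsets and $o=P\setminus\{r\}$ is its second largest element. For $D\subseteq \mathrm{Up}(P)^2$, with a variable $p_a$ for each $a\in \mathrm{Up}(P)$, $\alpha(P,D)$ is the formula $\Delta\to p_o$, where $\Delta$ is the conjunction of $p_{\varnothing}\leftrightarrow\bot$, $p_P\leftrightarrow\top$, all $p_{a\ast b}\leftrightarrow(p_a\ast p_b)$ for $a,b\in \mathrm{Up}(P)$, $\ast\in\{\wedge,\to\}$ (operations of $\mathrm{Up}(P)$ in the subscript), and all $p_{a\vee b}\leftrightarrow(p_a\vee p_b)$ for $(a,b)\in D$. **Tiling poset.** Given finite tile sets $\mathcal{W}_{i,j}$ ($i,j\in\{0,1\}$), the poset $P_{\mathcal{W}}$ has: four maximal points $\mathsf{H}_0,\mathsf{H}_1,\mathsf{V}_0,\mathsf{V}_1$; points $\mathsf{R}_*,\mathsf{R}_{01},\mathsf{R}_{10}$, each with immediate successors exactly $\mathsf{H}_0,\mathsf{H}_1$; points $\mathsf{S}_*,\mathsf{S}_{01},\mathsf{S}_{10}$, each with immediate successors exactly $\mathsf{V}_0,\mathsf{V}_1$; for all $i,j\in\{0,1\}$ and $t\in\mathcal{W}_{i,j}$ a point $\mathsf{T}_{i,j,t}$ with immediate successors exactly $\mathsf{H}_i,\mathsf{V}_j$; for each maximal point $x$ a point $s_x$ with only immediate successor $x$ and a point $c_x$ with only immediate successor $s_x$; and a root $r$ below everything. **Tiling domain.** $D_{\mathcal{W}}\subseteq \mathrm{Up}(P_{\mathcal{W}})^2$ consists of the following pairs. (i)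 $(\{X\},\{Y\})$ for $(X,Y)$ among $(\mathsf{H}_0,\mathsf{H}_1),(\mathsf{V}_0,\mathsf{V}_1)$ and $(\mathsf{H}_i,\mathsf{V}_j)$, $i,j\in\{0,1\}$. (ii) $(P_{\mathcal{W}}\setminus(N\cup\{Q,r\}),\,P_{\mathcal{W}}\setminus\{Q,c_T,r\})$ for $(T,N,Q)$ among $(\mathsf{H}_1,\{\mathsf{R}_*,\mathsf{R}_{10}\},\mathsf{R}_{01})$, $(\mathsf{H}_0,\{\mathsf{R}_*,\mathsf{R}_{01}\},\mathsf{R}_{10})$, $(\mathsf{V}_1,\{\mathsf{S}_*,\mathsf{S}_{10}\},\mathsf{S}_{01})$, $(\mathsf{V}_0,\{\mathsf{S}_*,\mathsf{S}_{01}\},\mathsf{S}_{10})$. (iii) For $i,j\in\{0,1\}$, $t\in\mathcal{W}_{i,j}$, with $G=\{\mathsf{T}_{1-i,j,t'}:t'\in\mathcal{W}_{1-i,j},\,t_E=t'_W\}$, $\mathsf{R}_0:=\mathsf{R}_{01}$, $\mathsf{R}_1:=\mathsf{R}_{10}$: the pair $(P_{\mathcal{W}}\setminus(\{\mathsf{T}_{i,j,t},s_{\mathsf{H}_i},c_{\mathsf{H}_i},r\}\cup G),\,P_{\mathcal{W}}\setminus(\{\mathsf{R}_i,s_{\mathsf{H}_i},c_{\mathsf{H}_i},r\}\cup G))$. (iv) For $i,j\in\{0,1\}$, $t\in\mathcal{W}_{i,j}$, with $G'=\{\mathsf{T}_{i,1-j,t'}:t'\in\mathcal{W}_{i,1-j},\,t_N=t'_S\}$,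 $\mathsf{S}_0:=\mathsf{S}_{01}$, $\mathsf{S}_1:=\mathsf{S}_{10}$: the pair $(P_{\mathcal{W}}\setminus(\{\mathsf{T}_{i,j,t},s_{\mathsf{V}_j},c_{\mathsf{V}_j},r\}\cup G'),\,P_{\mathcal{W}}\setminus(\{\mathsf{S}_j,s_{\mathsf{V}_j},c_{\mathsf{V}_j},r\}\cup G'))$. *)

theory Defs
  imports Main "HOL-Library.Countable_Set" "HOL-Library.Infinite_Typeclass"
begin

section \<open>Posets and their upsets\<close>

text \<open>
  As in \<^theory>\<open>HOL.Order_Relation\<close>, a poset is a relation \<open>P\<close> with
  \<^prop>\<open>Partial_order P\<close>; its carrier is \<^term>\<open>Field P\<close>, and \<^prop>\<open>(x, y) \<in> P\<close> means
  that \<open>x\<close> lies below \<open>y\<close>.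
\<close>

definition Up :: "'w rel \<Rightarrow> 'w set set" where
  "Up P = {U. U \<subseteq> Field P \<and> P `` U \<subseteq> U}"

definition up_imp :: "'w rel \<Rightarrow> 'w set \<Rightarrow> 'w set \<Rightarrow> 'w set" where
  "up_imp P a b = {x \<in> Field P. \<forall>y. (x, y) \<in> P \<longrightarrow> y \<in> a \<longrightarrow> y \<in> b}"

definition root :: "'w rel \<Rightarrow> 'w" where
  "root P = (THE r. r \<in> Field P \<and> (\<forall>x\<in>Field P. (r, x) \<in> P))"

section \<open>Intuitionistic propositional formulas and Kripke semantics\<close>

datatype form = Var nat | Bot | And form form | Or form form | Imp form form

abbreviation Top :: form where "Top \<equiv> Imp Bot Bot"

abbreviation Iff :: "form \<Rightarrow> form \<Rightarrow> form" where
  "Iff \<phi> \<psi> \<equiv> And (Imp \<phi> \<psi>) (Imp \<psi> \<phi>)"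

text \<open>
  The conjunction of a finite set of formulas, taken in some unspecified order
  (which is irrelevant up to logical equivalence).
\<close>

definition Conj :: "form set \<Rightarrow> form" where
  "Conj F = foldr And (SOME fs. set fs = F \<and> distinct fs) Top"

primrec forces :: "'w rel \<Rightarrow> (nat \<Rightarrow> 'w set) \<Rightarrow> 'w \<Rightarrow> form \<Rightarrow> bool" where
  "forces P v w (Var n) \<longleftrightarrow> w \<in> v n"
| "forces P v w Bot \<longleftrightarrow> False"
| "forces P v w (And \<phi> \<psi>) \<longleftrightarrow> forces P v w \<phi> \<and> forces P v w \<psi>"
| "forces P v w (Or \<phi> \<psi>) \<longleftrightarrow> forces P v w \<phi> \<or> forces P v w \<psi>"
| "forces P v w (Imp \<phi> \<psi>) \<longleftrightarrow>
     (\<forall>u. (w, u) \<in> P \<longrightarrow> forces P v u \<phi> \<longrightarrow> forces P v u \<psi>)"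

definition valid :: "'w rel \<Rightarrow> form \<Rightarrow> bool" where
  "valid P \<phi> \<longleftrightarrow> (\<forall>v. (\<forall>n. v n \<in> Up P) \<longrightarrow> (\<forall>w\<in>Field P. forces P v w \<phi>))"

section \<open>The logics of Medvedev and Skvortsov\<close>

definition medvedev_frame :: "'a set \<Rightarrow> 'a set rel" where
  "medvedev_frame I = {(X, Y). X \<in> Pow I - {{}} \<and> Y \<in> Pow I - {{}} \<and> X \<supseteq> Y}"

text \<open>
  HOL has no type of all sets, so ``all sets'' is rendered as all sets of elements of a
  type \<open>'a\<close>, an arbitrary infinite universe over which theorems are polymorphic.
  As \<open>'a\<close> is infinite it has subsets of every finite cardinality, so \<open>Medvedev_logic TYPE('a)\<close>
  does not depend on \<open>'a\<close>.
\<close>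

definition Medvedev_logic :: "'a::infinite itself \<Rightarrow> form set" where
  "Medvedev_logic _ = {\<phi>. \<forall>I :: 'a set. finite I \<longrightarrow> valid (medvedev_frame I) \<phi>}"

definition Skvortsov_logic :: "'a::infinite itself \<Rightarrow> form set" where
  "Skvortsov_logic _ = {\<phi>. \<forall>I :: 'a set. valid (medvedev_frame I) \<phi>}"

section \<open>Canonical formulas\<close>

text \<open>
  The variables \<open>p\<^sub>a\<close>, one for each upset \<open>a\<close>, are pairwise distinct, because
  \<^term>\<open>to_nat_on A\<close> is injective on the countable set \<open>A\<close>.
\<close>

definition upvar :: "'w rel \<Rightarrow> 'w set \<Rightarrow> form" where
  "upvar P a = Var (to_nat_on (Up P) a)"

definition canonical_premises :: "'w rel \<Rightarrow> ('w set \<times> 'w set) set \<Rightarrow> form set" where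
  "canonical_premises P D = (let p = upvar P in
     {Iff (p {}) Bot, Iff (p (Field P)) Top} \<union>
     {Iff (p (a \<inter> b)) (And (p a) (p b)) | a b. a \<in> Up P \<and> b \<in> Up P} \<union>
     {Iff (p (up_imp P a b)) (Imp (p a) (p b)) | a b. a \<in> Up P \<and> b \<in> Up P} \<union>
     {Iff (p (a \<union> b)) (Or (p a) (p b)) | a b. (a, b) \<in> D})"

definition canonical_formula :: "'w rel \<Rightarrow> ('w set \<times> 'w set) set \<Rightarrow> form" where
  "canonical_formula P D =
     Imp (Conj (canonical_premises P D)) (upvar P (Field P - {root P}))"

section \<open>Wang tilings\<close>

datatype tile = Tile (west: nat) (east: nat) (north: nat) (south: nat)

definition plane_tiling :: "tile set \<Rightarrow> (int \<Rightarrow> int \<Rightarrow> tile) \<Rightarrow> bool" where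
  "plane_tiling W \<tau> \<longleftrightarrow>
     (\<forall>k l. \<tau> k l \<in> W \<and>
            east (\<tau> k l) = west (\<tau> (k + 1) l) \<and>
            north (\<tau> k l) = south (\<tau> k (l + 1)))"

text \<open>The cyclic groups of orders \<open>m\<close> and \<open>n\<close> are represented by \<open>{..<m}\<close> and \<open>{..<n}\<close>.\<close>

definition periodic_tiling :: "tile set \<Rightarrow> nat \<Rightarrow> nat \<Rightarrow> (nat \<Rightarrow> nat \<Rightarrow> tile) \<Rightarrow> bool" where
  "periodic_tiling W m n \<tau> \<longleftrightarrow> m > 0 \<and> n > 0 \<and>
     (\<forall>k<m. \<forall>l<n. \<tau> k l \<in> W \<and>
            east (\<tau> k l) = west (\<tau> ((k + 1) mod m) l) \<and>
            north (\<tau> k l) = south (\<tau> k ((l + 1) mod n)))"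

definition aperiodic :: "tile set \<Rightarrow> bool" where
  "aperiodic W \<longleftrightarrow> (\<exists>\<tau>. plane_tiling W \<tau>) \<and> \<not> (\<exists>m n \<tau>. periodic_tiling W m n \<tau>)"

section \<open>The tiling poset and the tiling domain\<close>

text \<open>
  The indices \<open>0\<close> and \<open>1\<close> are rendered as \<^const>\<open>False\<close> and \<^const>\<open>True\<close>, so
  \<open>1 - i\<close> becomes \<open>\<not> i\<close>. \<open>sH i\<close> and \<open>cH i\<close> are the points \<open>s\<^sub>x\<close> and \<open>c\<^sub>x\<close>
  for the maximal point \<open>x = Hpt i\<close>; likewise \<open>sV j\<close> and \<open>cV j\<close> for \<open>Vpt j\<close>.
\<close>

datatype point =
    Hpt bool | Vpt bool
  | Rstar | R01 | R10
  | Sstar | S01 | S10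
  | Tpt bool bool tile
  | sH bool | sV bool | cH bool | cV bool
  | Root

definition points :: "(bool \<Rightarrow> bool \<Rightarrow> tile set) \<Rightarrow> point set" where
  "points W =
     range Hpt \<union> range Vpt \<union> {Rstar, R01, R10} \<union> {Sstar, S01, S10} \<union>
     {Tpt i j t | i j t. t \<in> W i j} \<union>
     range sH \<union> range sV \<union> range cH \<union> range cV \<union> {Root}"

text \<open>
  Immediate successors of the points other than the root, which is placed below
  everything separately.
\<close>

fun succs :: "point \<Rightarrow> point set" where
  "succs Rstar = range Hpt"
| "succs R01 = range Hpt"
| "succs R10 = range Hpt"
| "succs Sstar = range Vpt"
| "succs S01 = range Vpt"
| "succs S10 = range Vpt"
| "succs (Tpt i j t) = {Hpt i, Vpt j}"
| "succs (sH i) = {Hpt i}"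
| "succs (sV j) = {Vpt j}"
| "succs (cH i) = {sH i}"
| "succs (cV j) = {sV j}"
| "succs _ = {}"

definition tiling_poset :: "(bool \<Rightarrow> bool \<Rightarrow> tile set) \<Rightarrow> point rel" where
  "tiling_poset W = {(x, y). x \<in> points W \<and> y \<in> points W \<and>
     (x = Root \<or> (x, y) \<in> {(u, w). w \<in> succs u}\<^sup>*)}"

definition Rdir :: "bool \<Rightarrow> point" where "Rdir i = (if i then R10 else R01)"
definition Sdir :: "bool \<Rightarrow> point" where "Sdir j = (if j then S10 else S01)"

definition east_matches ::
  "(bool \<Rightarrow> bool \<Rightarrow> tile set) \<Rightarrow> bool \<Rightarrow> bool \<Rightarrow> tile \<Rightarrow> point set" where
  "east_matches W i j t = {Tpt (\<not> i) j t' | t'. t' \<in> W (\<not> i) j \<and> east t = west t'}"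

definition north_matches ::
  "(bool \<Rightarrow> bool \<Rightarrow> tile set) \<Rightarrow> bool \<Rightarrow> bool \<Rightarrow> tile \<Rightarrow> point set" where
  "north_matches W i j t = {Tpt i (\<not> j) t' | t'. t' \<in> W i (\<not> j) \<and> north t = south t'}"

definition tiling_domain ::
  "(bool \<Rightarrow> bool \<Rightarrow> tile set) \<Rightarrow> (point set \<times> point set) set" where
  "tiling_domain W =
     {({Hpt False}, {Hpt True}), ({Vpt False}, {Vpt True})} \<union>
     {({Hpt i}, {Vpt j}) | i j. True} \<union>
     {(points W - (N \<union> {Q, Root}), points W - {Q, c, Root}) | c N Q.
        (c, N, Q) \<in> {(cH True, {Rstar, R10}, R01), (cH False, {Rstar, R01}, R10),
                      (cV True, {Sstar, S10}, S01), (cV False, {Sstar, S01}, S10)}} \<union>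
     {(points W - ({Tpt i j t, sH i, cH i, Root} \<union> east_matches W i j t),
       points W - ({Rdir i, sH i, cH i, Root} \<union> east_matches W i j t)) | i j t. t \<in> W i j} \<union>
     {(points W - ({Tpt i j t, sV j, cV j, Root} \<union> north_matches W i j t),
       points W - ({Sdir j, sV j, cV j, Root} \<union> north_matches W i j t)) | i j t. t \<in> W i j}"

definition tiling_formula :: "(bool \<Rightarrow> bool \<Rightarrow> tile set) \<Rightarrow> form" where
  "tiling_formula W = canonical_formula (tiling_poset W) (tiling_domain W)"

section \<open>Basic facts\<close>

lemma Field_medvedev_frame: "Field (medvedev_frame I) = Pow I - {{}}"
  by (auto simp: medvedev_frame_def Field_def)

lemma Partial_order_medvedev_frame: "Partial_order (medvedev_frame I)"
  unfolding partial_order_on_def preorder_on_def Field_medvedev_frame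
  by (auto simp: medvedev_frame_def refl_on_def trans_def antisym_def)

lemma Field_tiling_poset: "Field (tiling_poset W) = points W"
  by (auto simp: tiling_poset_def Field_def)

lemma finite_points: "(\<And>i j. finite (W i j)) \<Longrightarrow> finite (points W)"
proof -
  assume fin: "\<And>i j. finite (W i j)"
  have "{Tpt i j t | i j t. t \<in> W i j} = (\<Union>i j. Tpt i j ` W i j)" by auto
  then show ?thesis using fin by (simp add: points_def)
qed

lemma succs_rtrancl_iff:
  "(x, y) \<in> {(u, w). w \<in> succs u}\<^sup>* \<longleftrightarrow> y = x \<or> y \<in> succs x \<or> (\<exists>z\<in>succs x. y \<in> succs z)"
proof
  assume "(x, y) \<in> {(u, w). w \<in> succs u}\<^sup>*"
  then show "y = x \<or> y \<in> succs x \<or> (\<exists>z\<in>succs x. y \<in> succs z)"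
  proof (induction rule: rtrancl_induct)
    case base
    show ?case by simp
  next
    case (step y z)
    from step.hyps(2) step.IH show ?case by - (cases x; auto)
  qed
next
  assume "y = x \<or> y \<in> succs x \<or> (\<exists>z\<in>succs x. y \<in> succs z)"
  then show "(x, y) \<in> {(u, w). w \<in> succs u}\<^sup>*"
    by (auto intro: rtrancl_into_rtrancl)
qed

lemma Partial_order_tiling_poset: "Partial_order (tiling_poset W)"
proof -
  have "antisym (tiling_poset W)"
  proof (rule antisymI)
    fix x y assume "(x, y) \<in> tiling_poset W" "(y, x) \<in> tiling_poset W"
    then show "x = y"
      by - (cases x; cases y; auto simp: tiling_poset_def succs_rtrancl_iff)
  qed
  moreover have "trans (tiling_poset W)"
  proof (rule transI)
    fix x y z assume a: "(x, y) \<in> tiling_poset W" "(y, z) \<in> tiling_poset W"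
    have "x = Root" if "y = Root"
      using a(1) that by - (cases x; auto simp: tiling_poset_def succs_rtrancl_iff)
    then show "(x, z) \<in> tiling_poset W"
      using a by (auto simp: tiling_poset_def intro: rtrancl_trans)
  qed
  moreover have "refl_on (points W) (tiling_poset W)"
    by (auto simp: tiling_poset_def refl_on_def)
  moreover have "tiling_poset W \<subseteq> points W \<times> points W"
    by (auto simp: tiling_poset_def)
  ultimately show ?thesis
    by (simp add: partial_order_on_def preorder_on_def Field_tiling_poset)
qed

lemma root_tiling_poset: "root (tiling_poset W) = Root"
  unfolding root_def Field_tiling_poset
proof (rule the_equality)
  show "Root \<in> points W \<and> (\<forall>x\<in>points W. (Root, x) \<in> tiling_poset W)"
    by (auto simp: tiling_poset_def points_def)
next
  fix r assume r: "r \<in> points W \<and> (\<forall>x\<in>points W. (r, x) \<in> tiling_poset W)"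
  have "Root \<in> points W" by (simp add: points_def)
  then have "(r, Root) \<in> tiling_poset W" using r by blast
  then show "r = Root"
    by (cases r) (auto simp: tiling_poset_def succs_rtrancl_iff)
qed

lemma tiling_domain_subset:
  "tiling_domain W \<subseteq> Up (tiling_poset W) \<times> Up (tiling_poset W)"
proof -
  have up: "U \<in> Up (tiling_poset W)"
    if "U \<subseteq> points W" "Root \<notin> U" "\<And>x. x \<in> U \<Longrightarrow> succs x \<subseteq> U" for U
    using that unfolding Up_def Field_tiling_poset
    by (auto simp: tiling_poset_def succs_rtrancl_iff) blast+
  have closed: "succs x \<subseteq> points W" if "x \<in> points W" for x
    using that by (auto simp: points_def)
  have diff: "points W - A \<in> Up (tiling_poset W)"
    if "Root \<in> A" "\<And>x y. \<lbrakk>x \<in> points W; y \<in> succs x; y \<in> A\<rbrakk> \<Longrightarrow> x \<in> A" for A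
    by (rule up) (use that closed in blast)+
  have sing: "{Hpt i} \<in> Up (tiling_poset W)" "{Vpt i} \<in> Up (tiling_poset W)" for i
    by (rule up; auto simp: points_def)+
  have inv: "y \<in> succs x \<Longrightarrow> (\<exists>i. y = Hpt i) \<or> (\<exists>i. y = Vpt i)
      \<or> (\<exists>i. y = sH i \<and> x = cH i) \<or> (\<exists>i. y = sV i \<and> x = cV i)" for x y
    by (cases x) auto
  show ?thesis
    unfolding tiling_domain_def
    by (auto intro!: diff sing dest!: inv
        simp: Rdir_def Sdir_def east_matches_def north_matches_def split: if_splits)
qed

end

theory Submission imports Defs Complex_Main begin

text \<open>
  A refutation of the tiling formula on the frame of subsets of \<open>I\<close> is a monotone map \<open>g\<close> from
  non-empty subsets to upsets. It sends singletons to maximal points, which splits \<open>I\<close> into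
  columns (\<open>H\<close>) and rows (\<open>V\<close>) with parities; a column and a row span a tile, and two columns of
  different parity span one of the \<open>R\<close> points, of which \<open>R01\<close> and \<open>R10\<close> mark a step to the east.
  The tiling domain makes every column have an eastern and every row a northern neighbour, with
  matching tiles. If \<open>I\<close> is finite then following neighbours ends in a cycle, so there is a periodic
  tiling; conversely a tiling of the plane can be read as such a map on a countable \<open>I\<close>.
  So an aperiodic tile set separates the logics. Such a set is obtained from Beatty sequences
  along a bi-infinite orbit of the bijection \<open>x \<mapsto> 2 x\<close> (\<open>x < 3 / 2\<close>), \<open>x \<mapsto> 2 x / 3\<close> (\<open>x \<ge> 3 / 2\<close>)
  of \<open>[1, 3)\<close>; it has no periodic tiling because no positive power of \<open>2\<close> is a power of \<open>3\<close>.
\<close>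

section \<open>An aperiodic set of Wang tiles\<close>

text \<open>
  Kari's idea: a row of tiles multiplies the sum of its south labels by \<open>2\<close> or \<open>2 / 3\<close>. The
  factor is recorded in the parity of the west and east labels, which otherwise carry the
  remainder.
\<close>

definition multiplier :: "tile \<Rightarrow> bool" where
  "multiplier t \<longleftrightarrow> 0 < south t \<and> even (west t) = even (east t) \<and>
     2 * south t + west t div 2 = (if even (west t) then 1 else 3) * north t + east t div 2"

section \<open>Multiplier tiles admit no periodic tiling\<close>

lemma sum_mod_shift:
  fixes f :: "nat \<Rightarrow> 'b::comm_monoid_add"
  assumes "m > 0"
  shows "(\<Sum>k<m. f ((k + 1) mod m)) = (\<Sum>k<m. f k)"
proof -
  obtain m' where m: "m = Suc m'" using assms by (cases m) auto
  have "(\<Sum>k<m. f ((k + 1) mod m)) = (\<Sum>k<m'. f (Suc k)) + f 0"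
    by (simp add: m)
  also have "\<dots> = (\<Sum>k<m. f k)"
    by (simp only: m sum.lessThan_Suc_shift) (simp add: add.commute)
  finally show ?thesis .
qed

lemma prod_mod_shift:
  fixes f :: "nat \<Rightarrow> 'b::comm_monoid_mult"
  assumes "m > 0"
  shows "(\<Prod>k<m. f ((k + 1) mod m)) = (\<Prod>k<m. f k)"
proof -
  obtain m' where m: "m = Suc m'" using assms by (cases m) auto
  have "(\<Prod>k<m. f ((k + 1) mod m)) = (\<Prod>k<m'. f (Suc k)) * f 0"
    by (simp add: m)
  also have "\<dots> = (\<Prod>k<m. f k)"
    by (simp only: m prod.lessThan_Suc_shift) (simp add: mult.commute)
  finally show ?thesis .
qed

text \<open>Around a cyclic row the remainders cancel, so twice the sum of the south labels is
  \<open>1\<close> or \<open>3\<close> times that of the next row. Multiplying over the cycle of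
  rows and cancelling the positive sums leaves \<open>2 ^ n\<close> equal to an odd number.\<close>

lemma no_periodic_multiplier_tiling:
  assumes W: "\<And>t. t \<in> W \<Longrightarrow> multiplier t"
  shows "\<not> periodic_tiling W m n \<tau>"
proof
  assume per: "periodic_tiling W m n \<tau>"
  then have m: "m > 0" and n: "n > 0" by (auto simp: periodic_tiling_def)
  have mul: "multiplier (\<tau> k l)"
    and east: "east (\<tau> k l) = west (\<tau> ((k + 1) mod m) l)"
    and north: "north (\<tau> k l) = south (\<tau> k ((l + 1) mod n))" if "k < m" "l < n" for k l
    using per that W by (auto simp: periodic_tiling_def)
  define S where "S l = (\<Sum>k<m. south (\<tau> k l))" for l
  define c where "c l = (if even (west (\<tau> 0 l)) then 1 else 3 :: nat)" for l
  have pos: "S l > 0" if "l < n" for l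
    using mul that m by (auto simp: S_def multiplier_def intro!: sum_pos)
  have step: "2 * S l = c l * S ((l + 1) mod n)" if l: "l < n" for l
  proof -
    \<comment> \<open>The parity of the horizontal labels is passed on along a row, so
      \<open>c l\<close> is the factor of the whole row.\<close>
    have par: "k < m \<Longrightarrow> even (west (\<tau> k l)) = even (west (\<tau> 0 l))" for k
    proof (induction k)
      case (Suc k)
      then show ?case using mul[of k l] east[of k l] l by (auto simp: multiplier_def)
    qed simp
    have "2 * south (\<tau> k l) + west (\<tau> k l) div 2
        = c l * south (\<tau> k ((l + 1) mod n)) + west (\<tau> ((k + 1) mod m) l) div 2" if "k < m" for k
      using mul[OF that l] east[OF that l] north[OF that l] par[OF that]
      by (auto simp: multiplier_def c_def)
    then have "(\<Sum>k<m. 2 * south (\<tau> k l) + west (\<tau> k l) div 2)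
        = (\<Sum>k<m. c l * south (\<tau> k ((l + 1) mod n)) + west (\<tau> ((k + 1) mod m) l) div 2)"
      by (intro sum.cong) auto
    then show ?thesis
      using sum_mod_shift[OF m, of "\<lambda>k. west (\<tau> k l) div 2"]
      by (simp add: S_def sum.distrib sum_distrib_left)
  qed
  have "2 ^ n * (\<Prod>l<n. S l) = (\<Prod>l<n. 2 * S l)"
    by (simp add: prod.distrib)
  also have "\<dots> = (\<Prod>l<n. c l * S ((l + 1) mod n))"
    using step by (intro prod.cong) auto
  also have "\<dots> = (\<Prod>l<n. c l) * (\<Prod>l<n. S l)"
    using prod_mod_shift[OF n, of S] by (simp add: prod.distrib)
  finally have "2 ^ n = (\<Prod>l<n. c l)" using pos by (fastforce simp: prod_zero_iff)
  moreover have "odd (\<Prod>l<n. c l)" by (simp add: c_def even_prod_iff)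
  ultimately show False using n by (metis dvd_power even_numeral)
qed

section \<open>A plane tiling by multiplier tiles\<close>

lemma exists_bi_infinite_orbit:
  fixes f h :: "'b \<Rightarrow> 'b"
  assumes "x0 \<in> X" "\<And>x. x \<in> X \<Longrightarrow> f x \<in> X" "\<And>x. x \<in> X \<Longrightarrow> h x \<in> X \<and> f (h x) = x"
  shows "\<exists>x :: int \<Rightarrow> 'b. \<forall>l. x l \<in> X \<and> x (l + 1) = f (x l)"
proof (intro exI allI)
  fix l :: int
  \<comment> \<open>Forwards \<open>f\<close> is iterated, backwards its right inverse
    \<open>h\<close>.\<close>
  define x where "x l = (if l \<ge> 0 then (f ^^ nat l) x0 else (h ^^ nat (- l)) x0)" for l
  have f: "(f ^^ n) x0 \<in> X" and h: "(h ^^ n) x0 \<in> X" for n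
    using assms by (induction n) auto
  have "x (l + 1) = f (x l)"
  proof (cases "l \<ge> 0")
    case True
    then show ?thesis by (simp add: x_def nat_add_distrib)
  next
    case False
    then obtain n where l: "l = - int (Suc n)"
      by (metis add.inverse_inverse int_cases int_cases2 negative_zle_0 of_nat_0_le_iff of_nat_Suc)
    have "nat (- (l + 1)) = n" by (simp add: l)
    then have "x (l + 1) = (h ^^ n) x0"
      by (cases n) (auto simp: x_def l)
    moreover have "nat (- l) = Suc n" by (simp add: l)
    then have "x l = h ((h ^^ n) x0)" using False by (simp add: x_def)
    ultimately show ?thesis using assms(3) h by simp
  qed
  then show "x l \<in> X \<and> x (l + 1) = f (x l)" using f h by (simp add: x_def)
qed

lemma exists_aperiodic: "\<exists>W. finite W \<and> aperiodic W"
proof -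
  define f :: "real \<Rightarrow> real" where "f x = (if x < 3 / 2 then 2 * x else 2 * x / 3)" for x
  \<comment> \<open>\<open>h\<close> inverts \<open>f\<close> on \<open>[1, 3)\<close>: the branch
    \<open>x < 3 / 2\<close> has image \<open>[2, 3)\<close>, the other one
    \<open>[1, 2)\<close>.\<close>
  define h :: "real \<Rightarrow> real" where "h x = (if x < 2 then 3 * x / 2 else x / 2)" for x
  have f: "f y \<in> {1..<3}" and h: "h y \<in> {1..<3} \<and> f (h y) = y" if "y \<in> {1..<3}" for y
    using that by (auto simp: f_def h_def)
  have "\<exists>x :: int \<Rightarrow> real. \<forall>l. x l \<in> {1..<3} \<and> x (l + 1) = f (x l)"
    by (rule exists_bi_infinite_orbit[of 1 _ f h, OF _ f h]) simp
  then obtain x :: "int \<Rightarrow> real" where x: "\<And>l. x l \<in> {1..<3}" "\<And>l. x (l + 1) = f (x l)"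
    by blast
  \<comment> \<open>Differences of the Beatty sequence of \<open>x l\<close>. They lie between
    \<open>1\<close> and \<open>3\<close> since \<open>1 \<le> x l < 3\<close>, so
    \<open>nat\<close> truncates nothing.\<close>
  define s where "s k l = nat (\<lfloor>(k + 1) * x l\<rfloor> - \<lfloor>k * x l\<rfloor>)" for k l :: int
  define d :: "int \<Rightarrow> int" where "d l = (if x l < 3 / 2 then 1 else 3)" for l
  \<comment> \<open>The carry entering column \<open>k\<close>: the reals
    \<open>2 * (k * x l)\<close> and \<open>d l * (k * x (l + 1))\<close> agree, so the difference
    comes from rounding alone and exceeds \<open>-2\<close>; adding \<open>2\<close> makes it
    non-negative.\<close>
  define C where "C k l = 2 * \<lfloor>k * x l\<rfloor> - d l * \<lfloor>k * x (l + 1)\<rfloor> + 2" for k l :: int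
  \<comment> \<open>The lowest bit records the factor of the row, \<open>0\<close> for
    \<open>2\<close> and \<open>1\<close> for \<open>2 / 3\<close>.\<close>
  define c where "c k l = 2 * nat (C k l) + (if x l < 3 / 2 then 0 else 1)" for k l
  define \<tau> where "\<tau> k l = Tile (c k l) (c (k + 1) l) (s k (l + 1)) (s k l)" for k l
  have d: "d l * x (l + 1) = 2 * x l" for l
    using x(2)[of l] by (auto simp: f_def d_def)
  have s: "1 \<le> \<lfloor>(k + 1) * x l\<rfloor> - \<lfloor>k * x l\<rfloor>" "\<lfloor>(k + 1) * x l\<rfloor> - \<lfloor>k * x l\<rfloor> \<le> 3" for k l :: int
  proof -
    have "(k + 1) * x l = k * x l + x l" by (simp add: algebra_simps)
    then show "1 \<le> \<lfloor>(k + 1) * x l\<rfloor> - \<lfloor>k * x l\<rfloor>" "\<lfloor>(k + 1) * x l\<rfloor> - \<lfloor>k * x l\<rfloor> \<le> 3"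
      using x(1)[of l] by simp_all linarith+
  qed
  have C: "0 \<le> C k l" "C k l \<le> 5" for k l
  proof -
    have "d l * (k * x (l + 1)) = 2 * (k * x l)"
      using d[of l] by (metis mult.left_commute)
    \<comment> \<open>\<open>2 * \<lfloor>u\<rfloor> - e * \<lfloor>w\<rfloor>\<close> is
      \<open>e\<close> times the fractional part of \<open>w\<close> minus twice that of
      \<open>u\<close>, hence strictly between \<open>-2\<close> and \<open>3\<close>.\<close>
    moreover have "0 \<le> 2 * \<lfloor>u\<rfloor> - e * \<lfloor>w\<rfloor> + 2 \<and> 2 * \<lfloor>u\<rfloor> - e * \<lfloor>w\<rfloor> + 2 \<le> 5"
      if "e * w = 2 * u" "e = 1 \<or> e = 3" for u w :: real and e :: int
      using that(2)
    proof
      assume "e = 1"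
      then show ?thesis using that(1) by simp linarith
    next
      assume "e = 3"
      then show ?thesis using that(1) by simp linarith
    qed
    moreover have "d l = 1 \<or> d l = 3" by (simp add: d_def)
    ultimately show "0 \<le> C k l" "C k l \<le> 5" unfolding C_def by blast+
  qed
  have mul: "multiplier (\<tau> k l)" for k l
  proof -
    have "2 * s k l + nat (C k l) = nat (d l) * s k (l + 1) + nat (C (k + 1) l)"
    proof -
      \<comment> \<open>Both sides telescope to \<open>2 * \<lfloor>(k + 1) * x l\<rfloor> - d l *
        \<lfloor>k * x (l + 1)\<rfloor> + 2\<close>.\<close>
      have "int (2 * s k l + nat (C k l)) = 2 * (\<lfloor>(k + 1) * x l\<rfloor> - \<lfloor>k * x l\<rfloor>) + C k l"
        using s(1)[of k l] C(1) by (simp add: s_def)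
      also have "\<dots> = d l * (\<lfloor>(k + 1) * x (l + 1)\<rfloor> - \<lfloor>k * x (l + 1)\<rfloor>) + C (k + 1) l"
        by (simp add: C_def algebra_simps)
      also have "\<dots> = int (nat (d l) * s k (l + 1) + nat (C (k + 1) l))"
        using s(1)[of k "l + 1"] C(1) by (simp add: s_def d_def)
      finally show ?thesis by linarith
    qed
    moreover have "0 < s k l" using s(1)[of k l] by (simp add: s_def)
    ultimately show ?thesis by (auto simp: multiplier_def \<tau>_def c_def d_def split: if_splits)
  qed
  define W where "W = {\<tau> k l | k l. True}"
  \<comment> \<open>Carries are at most \<open>5\<close>, so horizontal labels are at most
    \<open>2 * 5 + 1\<close>.\<close>
  have bounds: "s k l \<le> 11" "c k l \<le> 11" for k l
    using s(2)[of k l] C(2)[of k l] by (auto simp: s_def c_def)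
  have "W \<subseteq> (\<lambda>(w, e, n, s). Tile w e n s) ` ({..11} \<times> {..11} \<times> {..11} \<times> {..11})"
    unfolding W_def \<tau>_def using bounds
    by (auto intro!: image_eqI[where x = "(c k l, c (k + 1) l, s k (l + 1), s k l)" for k l])
  then have "finite W" by (rule finite_subset) simp
  moreover have "plane_tiling W \<tau>" by (auto simp: plane_tiling_def W_def \<tau>_def)
  moreover have "\<not> periodic_tiling W m n \<tau>'" for m n \<tau>'
    by (rule no_periodic_multiplier_tiling) (auto simp: W_def mul)
  ultimately show ?thesis unfolding aperiodic_def by blast
qed

section \<open>Refutation of canonical formulas\<close>

lemma forces_Conj:
  assumes "finite F"
  shows "forces P v w (Conj F) \<longleftrightarrow> (\<forall>\<phi>\<in>F. forces P v w \<phi>)"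
proof -
  define fs where "fs = (SOME fs. set fs = F \<and> distinct fs)"
  have fs: "set fs = F"
    unfolding fs_def using someI_ex[OF finite_distinct_list[OF assms]] by blast
  have "forces P v w (foldr And gs Top) \<longleftrightarrow> (\<forall>\<phi>\<in>set gs. forces P v w \<phi>)" for gs
    by (induction gs) auto
  then show ?thesis by (simp add: Conj_def fs flip: fs_def)
qed

lemma forces_Iff:
  "forces P v w (Iff \<phi> \<psi>) \<longleftrightarrow> (\<forall>u. (w, u) \<in> P \<longrightarrow> forces P v u \<phi> = forces P v u \<psi>)"
  by auto

lemma finite_Up: "finite (Field P) \<Longrightarrow> finite (Up P)"
  by (rule finite_subset[of _ "Pow (Field P)"]) (auto simp: Up_def)

text \<open>Finiteness is what gives \<open>Conj\<close> its meaning, since only a finite set can be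
  listed.\<close>

lemma finite_canonical_premises:
  assumes "finite (Field P)" "D \<subseteq> Up P \<times> Up P"
  shows "finite (canonical_premises P D)"
proof -
  note fin = finite_Up[OF assms(1)]
  have "finite {f a b | a b. a \<in> Up P \<and> b \<in> Up P}" for f :: "_ \<Rightarrow> _ \<Rightarrow> form"
    by (rule finite_image_set2[of "\<lambda>a. a \<in> Up P" "\<lambda>a. a \<in> Up P"]) (use fin in simp_all)
  moreover have "finite {f a b | a b. (a, b) \<in> D}" for f :: "_ \<Rightarrow> _ \<Rightarrow> form"
  proof -
    have "finite (case_prod f ` D)"
      using assms(2) fin by (meson finite_SigmaI finite_imageI finite_subset)
    moreover have "{f a b | a b. (a, b) \<in> D} = case_prod f ` D" by force
    ultimately show ?thesis by simp
  qed
  ultimately show ?thesis by (simp add: canonical_premises_def Let_def)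
qed

lemma Up_Int: "a \<in> Up P \<Longrightarrow> b \<in> Up P \<Longrightarrow> a \<inter> b \<in> Up P"
  and Up_Un: "a \<in> Up P \<Longrightarrow> b \<in> Up P \<Longrightarrow> a \<union> b \<in> Up P"
  and Up_empty: "{} \<in> Up P"
  and Up_Field: "Field P \<in> Up P"
  by (auto simp: Up_def Field_def)

lemma up_imp_Up: "trans P \<Longrightarrow> up_imp P a b \<in> Up P"
  by (auto simp: Up_def up_imp_def Field_def dest: transD)

text \<open>The residuation law of the Heyting algebra of upsets.\<close>

lemma subset_up_imp_iff:
  assumes "Partial_order P" "c \<in> Up P"
  shows "c \<subseteq> up_imp P a b \<longleftrightarrow> c \<inter> a \<subseteq> b"
proof -
  have "refl_on (Field P) P"
    using assms(1) by (auto simp: partial_order_on_def preorder_on_def)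
  then show ?thesis using assms(2)
    by (auto simp: up_imp_def Up_def refl_on_def)
qed

lemma Up_remove_root:
  assumes "Partial_order P" "root P \<in> Field P" "\<And>x. x \<in> Field P \<Longrightarrow> (root P, x) \<in> P"
  shows "Field P - {root P} \<in> Up P"
proof -
  have "y \<noteq> root P" if "x \<noteq> root P" "(x, y) \<in> P" for x y
    using that assms(3)[of x] assms(1)
    by (auto simp: Field_def partial_order_on_def dest: antisymD)
  then show ?thesis by (auto simp: Up_def Field_def)
qed

text \<open>
  Evaluating \<open>p\<^sub>a\<close> as \<open>{x. g x \<subseteq> a}\<close> turns a refuting map \<open>g\<close> into a refutation of
  \<^term>\<open>canonical_formula P D\<close> at \<open>w\<close>, and all refutations arise like this, because in a finite
  algebra of upsets the filter \<open>{a. p\<^sub>a is forced at x}\<close> is principal.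
\<close>

definition refuting_map ::
  "'v rel \<Rightarrow> 'w rel \<Rightarrow> ('w set \<times> 'w set) set \<Rightarrow> 'v \<Rightarrow> ('v \<Rightarrow> 'w set) \<Rightarrow> bool" where
  "refuting_map F P D w g \<longleftrightarrow> g w = Field P \<and>
     (\<forall>x. (w, x) \<in> F \<longrightarrow>
        g x \<in> Up P \<and> g x \<noteq> {} \<and>
        (\<forall>y. (x, y) \<in> F \<longrightarrow> g y \<subseteq> g x) \<and>
        (\<forall>p\<in>g x. \<exists>y. (x, y) \<in> F \<and> g y = P `` {p}) \<and>
        (\<forall>a b. (a, b) \<in> D \<longrightarrow> g x \<subseteq> a \<union> b \<longrightarrow> g x \<subseteq> a \<or> g x \<subseteq> b))"

section \<open>Refutations and refuting maps\<close>

lemma refuting_map_if_not_valid: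
  fixes P :: "'w rel" and F :: "'v rel"
  assumes P: "Partial_order P" "finite (Field P)" "D \<subseteq> Up P \<times> Up P"
    and r: "root P \<in> Field P" "\<And>x. x \<in> Field P \<Longrightarrow> (root P, x) \<in> P"
    and F: "Partial_order F"
    and nv: "\<not> valid F (canonical_formula P D)"
  shows "\<exists>w g. w \<in> Field F \<and> refuting_map F P D w g"
proof -
  define k where "k = to_nat_on (Up P)"
  have transP: "trans P" and antiP: "antisym P" and reflP: "refl_on (Field P) P"
    and transF: "trans F" and reflF: "refl_on (Field F) F"
    using P(1) F by (auto simp: partial_order_on_def preorder_on_def)
  note finU = finite_Up[OF P(2)]
  \<comment> \<open>The failing implication supplies a point where all premises hold and the
    variable of the second largest upset does not.\<close>
  obtain v w where v: "\<And>n. v n \<in> Up F" and w: "w \<in> Field F"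
    and prem: "\<And>\<phi>. \<phi> \<in> canonical_premises P D \<Longrightarrow> forces F v w \<phi>"
    and ne: "w \<notin> v (k (Field P - {root P}))"
    using nv unfolding valid_def canonical_formula_def
    by (auto simp: forces_Conj finite_canonical_premises[OF P(2,3)] upvar_def k_def Field_def
        simp del: forces.simps(5)) (auto simp: Field_def forces_Conj finite_canonical_premises[OF P(2,3)])
  have ww: "(w, w) \<in> F" using reflF w by (simp add: refl_on_def)
  define g where "g x = \<Inter>{a \<in> Up P. x \<in> v (k a)}" for x
  have Iff_in: "forces F v x \<phi> = forces F v x \<psi>"
    if "(w, x) \<in> F" "Iff \<phi> \<psi> \<in> canonical_premises P D" for x \<phi> \<psi>
    using prem[OF that(2)] that(1) unfolding forces_Iff by blast
  have bot: "x \<notin> v (k {})" and top: "x \<in> v (k (Field P))" if "(w, x) \<in> F" for x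
    using Iff_in[OF that, of "upvar P {}" Bot] Iff_in[OF that, of "upvar P (Field P)" Top]
    by (auto simp: canonical_premises_def Let_def upvar_def k_def)
  have meet: "x \<in> v (k (a \<inter> b)) \<longleftrightarrow> x \<in> v (k a) \<and> x \<in> v (k b)"
    if "(w, x) \<in> F" "a \<in> Up P" "b \<in> Up P" for x a b
    using Iff_in[OF that(1), of "upvar P (a \<inter> b)" "And (upvar P a) (upvar P b)"] that(2,3)
    by (auto simp: canonical_premises_def Let_def upvar_def k_def)
  have imp: "x \<in> v (k (up_imp P a b)) \<longleftrightarrow> (\<forall>y. (x, y) \<in> F \<longrightarrow> y \<in> v (k a) \<longrightarrow> y \<in> v (k b))"
    if "(w, x) \<in> F" "a \<in> Up P" "b \<in> Up P" for x a b
    using Iff_in[OF that(1), of "upvar P (up_imp P a b)" "Imp (upvar P a) (upvar P b)"] that(2,3)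
    by (auto simp: canonical_premises_def Let_def upvar_def k_def)
  have join: "x \<in> v (k (a \<union> b)) \<longleftrightarrow> x \<in> v (k a) \<or> x \<in> v (k b)"
    if "(w, x) \<in> F" "(a, b) \<in> D" for x a b
    using Iff_in[OF that(1), of "upvar P (a \<union> b)" "Or (upvar P a) (upvar P b)"] that(2)
    by (auto simp: canonical_premises_def Let_def upvar_def k_def)
  \<comment> \<open>Closure under finite intersections puts the generator \<open>g x\<close> itself
    into the filter at \<open>x\<close>; by \<open>top\<close> the filter is not empty.\<close>
  have Inter: "\<Inter>A \<in> Up P \<and> x \<in> v (k (\<Inter>A))"
    if "finite A" "A \<noteq> {}" "A \<subseteq> {a \<in> Up P. x \<in> v (k a)}" "(w, x) \<in> F" for A x
    using that by (induction rule: finite_ne_induct) (auto simp: meet Up_Int)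
  have gI: "g x \<in> Up P \<and> x \<in> v (k (g x))" if "(w, x) \<in> F" for x
    unfolding g_def by (rule Inter) (use that top[OF that] finU Up_Field[of P] in auto)
  have g: "x \<in> v (k a) \<longleftrightarrow> g x \<subseteq> a" if "(w, x) \<in> F" "a \<in> Up P" for x a
  proof
    assume "g x \<subseteq> a"
    then have "g x \<inter> a = g x" by blast
    then show "x \<in> v (k a)" using meet[OF that(1), of "g x" a] gI[OF that(1)] that(2) by simp
  qed (use that(2) in \<open>auto simp: g_def\<close>)
  note o = Up_remove_root[OF P(1) r]
  have "g w = Field P"
  proof -
    \<comment> \<open>By \<open>ne\<close> the upset \<open>g w\<close> is not contained in
      \<open>Field P - {root P}\<close>, so it contains the root and hence everything.\<close>
    have "root P \<in> g w" using gI[OF ww] ne g[OF ww o] by (auto simp: Up_def)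
    then show ?thesis using gI[OF ww] r(2) by (auto simp: Up_def)
  qed
  moreover have "g y \<subseteq> g x" if "(x, y) \<in> F" for x y
  proof -
    have "x \<in> v n \<Longrightarrow> y \<in> v n" for n using v[of n] that by (auto simp: Up_def)
    then show ?thesis by (auto simp: g_def)
  qed
  \<comment> \<open>With no successor mapped to the principal upset of \<open>p\<close>, the
    implication from that upset to itself without \<open>p\<close> would hold at \<open>x\<close>,
    and residuation would exclude \<open>p\<close> from \<open>g x\<close>.\<close>
  moreover have "\<exists>y. (x, y) \<in> F \<and> g y = P `` {p}" if x: "(w, x) \<in> F" and p: "p \<in> g x" for x p
  proof (rule ccontr)
    assume no: "\<nexists>y. (x, y) \<in> F \<and> g y = P `` {p}"
    let ?a = "P `` {p}"
    have pF: "p \<in> Field P" using gI[OF x] p by (auto simp: Up_def)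
    then have pp: "p \<in> ?a" using reflP by (auto simp: refl_on_def)
    have a: "?a \<in> Up P" using transP by (auto simp: Up_def Field_def dest: transD)
    have b: "?a - {p} \<in> Up P" using a antiP by (auto simp: Up_def dest: antisymD)
    have "y \<in> v (k (?a - {p}))" if y: "(x, y) \<in> F" "y \<in> v (k ?a)" for y
    proof -
      have wy: "(w, y) \<in> F" using transF x y(1) by (meson transD)
      have "g y \<subseteq> ?a" using g[OF wy a] y(2) by blast
      \<comment> \<open>An upset that contains \<open>p\<close> and lies inside the principal upset
        of \<open>p\<close> is equal to it.\<close>
      moreover have "p \<notin> g y"
        using no y(1) \<open>g y \<subseteq> ?a\<close> gI[OF wy] unfolding Up_def by blast
      ultimately show ?thesis using g[OF wy b] by blast
    qed
    then have "x \<in> v (k (up_imp P ?a (?a - {p})))" using imp[OF x a b] by blast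
    then have "g x \<inter> ?a \<subseteq> ?a - {p}"
      using g[OF x up_imp_Up[OF transP]] subset_up_imp_iff[OF P(1)] gI[OF x] by simp
    then show False using p pp by blast
  qed
  moreover have "g x \<subseteq> a \<or> g x \<subseteq> b" if "(w, x) \<in> F" "(a, b) \<in> D" "g x \<subseteq> a \<union> b" for x a b
  proof -
    have "a \<in> Up P" "b \<in> Up P" using that(2) P(3) by auto
    then show ?thesis using join[OF that(1,2)] that(3) g[OF that(1)] Up_Un by blast
  qed
  moreover have "g x \<noteq> {}" if "(w, x) \<in> F" for x
    using g[OF that Up_empty] bot[OF that] by blast
  moreover have "\<And>x. (w, x) \<in> F \<Longrightarrow> g x \<in> Up P" using gI by blast
  ultimately have "refuting_map F P D w g" by (simp add: refuting_map_def)
  then show ?thesis using w by blast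
qed

text \<open>As \<open>w\<close> lies below all of \<open>F\<close>, the conditions on
  \<open>g\<close> hold throughout the frame, and each of them yields one kind of premise.\<close>

lemma not_valid_if_refuting_map:
  fixes P :: "'w rel" and F :: "'v rel"
  assumes P: "Partial_order P" "finite (Field P)" "D \<subseteq> Up P \<times> Up P"
    and r: "root P \<in> Field P" "\<And>x. x \<in> Field P \<Longrightarrow> (root P, x) \<in> P"
    and F: "Partial_order F" and w: "w \<in> Field F" "\<And>x. x \<in> Field F \<Longrightarrow> (w, x) \<in> F"
    and g: "refuting_map F P D w g"
  shows "\<not> valid F (canonical_formula P D)"
proof -
  have transP: "trans P" and antiP: "antisym P" and reflP: "refl_on (Field P) P"
    using P(1) by (auto simp: partial_order_on_def preorder_on_def)
  define k where "k = to_nat_on (Up P)"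
  have inj: "inj_on k (Up P)"
    unfolding k_def using finite_Up[OF P(2)] by (simp add: countable_finite inj_on_to_nat_on)
  \<comment> \<open>Numbers that encode no upset receive the empty set.\<close>
  define v where "v n = {x \<in> Field F. \<exists>a\<in>Up P. n = k a \<and> g x \<subseteq> a}" for n
  have gw: "g w = Field P" using g by (simp add: refuting_map_def)
  have gU: "g x \<in> Up P" and gne: "g x \<noteq> {}"
    and anti: "\<And>y. (x, y) \<in> F \<Longrightarrow> g y \<subseteq> g x"
    and wit: "\<And>p. p \<in> g x \<Longrightarrow> \<exists>y. (x, y) \<in> F \<and> g y = P `` {p}"
    and dom: "\<And>a b. (a, b) \<in> D \<Longrightarrow> g x \<subseteq> a \<union> b \<Longrightarrow> g x \<subseteq> a \<or> g x \<subseteq> b"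
    if "x \<in> Field F" for x
    using g w(2)[OF that] by (auto simp: refuting_map_def)
  have v: "x \<in> v (k a) \<longleftrightarrow> g x \<subseteq> a" if "a \<in> Up P" "x \<in> Field F" for a x
    using that inj by (auto simp: v_def inj_on_def)
  have vU: "v n \<in> Up F" for n
  proof -
    have "(x, y) \<in> F \<Longrightarrow> x \<in> v n \<Longrightarrow> y \<in> v n" for x y
      using anti[of x y] by (auto simp: v_def Field_def)
    then show ?thesis by (auto simp: Up_def v_def)
  qed
  have imp: "x \<in> v (k (up_imp P a b)) \<longleftrightarrow> (\<forall>y. (x, y) \<in> F \<longrightarrow> y \<in> v (k a) \<longrightarrow> y \<in> v (k b))"
    if ab: "a \<in> Up P" "b \<in> Up P" and x: "x \<in> Field F" for a b x
  proof -
    have "g x \<inter> a \<subseteq> b \<longleftrightarrow> (\<forall>y. (x, y) \<in> F \<longrightarrow> g y \<subseteq> a \<longrightarrow> g y \<subseteq> b)"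
    proof (intro iffI subsetI)
      fix p assume *: "\<forall>y. (x, y) \<in> F \<longrightarrow> g y \<subseteq> a \<longrightarrow> g y \<subseteq> b" and p: "p \<in> g x \<inter> a"
      \<comment> \<open>The condition on successors is tested at one whose image is the principal
        upset of \<open>p\<close>.\<close>
      obtain y where y: "(x, y) \<in> F" "g y = P `` {p}" using wit[OF x] p by blast
      have "g y \<subseteq> a" using y(2) p ab(1) by (auto simp: Up_def)
      then have "g y \<subseteq> b" using * y(1) by blast
      moreover have "p \<in> Field P" using p ab(1) by (auto simp: Up_def)
      ultimately show "p \<in> b" using y(2) reflP by (auto simp: refl_on_def)
    qed (use anti[OF x] in blast)
    moreover have "(x, y) \<in> F \<Longrightarrow> y \<in> Field F" for y by (auto simp: Field_def)
    ultimately show ?thesis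
      using v ab x up_imp_Up[OF transP] subset_up_imp_iff[OF P(1) gU[OF x]] by metis
  qed
  have "forces F v w \<phi>" if "\<phi> \<in> canonical_premises P D" for \<phi>
  proof -
    have fld: "x \<in> Field F" if "(w, x) \<in> F" for x using that by (auto simp: Field_def)
    have "g x \<subseteq> Field P" if "x \<in> Field F" for x using gU[OF that] by (auto simp: Up_def)
    moreover have "x \<in> v (k (a \<union> b)) \<longleftrightarrow> x \<in> v (k a) \<or> x \<in> v (k b)"
      if "(a, b) \<in> D" "x \<in> Field F" for a b x
    proof -
      have "a \<in> Up P" "b \<in> Up P" using that(1) P(3) by auto
      then show ?thesis using dom[OF that(2,1)] v[OF _ that(2)] by (auto simp: Up_Un)
    qed
    moreover note imp v fld gne
    ultimately show ?thesis using that unfolding canonical_premises_def Let_def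
      by (elim UnE insertE emptyE CollectE exE conjE; simp only: forces_Iff)
        (auto simp: upvar_def Up_Int Up_empty Up_Field simp flip: k_def)
  qed
  then have "forces F v w (Conj (canonical_premises P D))"
    by (simp add: forces_Conj finite_canonical_premises[OF P(2,3)])
  moreover note o = Up_remove_root[OF P(1) r]
  have "w \<notin> v (k (Field P - {root P}))"
    using v[OF o w(1)] gw r(1) by blast
  moreover have "(w, w) \<in> F" using w by blast
  ultimately have "\<not> forces F v w (canonical_formula P D)"
    unfolding canonical_formula_def k_def by (auto simp: upvar_def)
  then show ?thesis using vU w(1) unfolding valid_def by blast
qed

section \<open>Finite Medvedev frames yield periodic tilings\<close>

lemma points_simps [simp]:
  "Hpt i \<in> points W" "Vpt i \<in> points W" "Rstar \<in> points W" "R01 \<in> points W" "R10 \<in> points W"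
  "Sstar \<in> points W" "S01 \<in> points W" "S10 \<in> points W" "sH i \<in> points W" "sV i \<in> points W"
  "cH i \<in> points W" "cV i \<in> points W" "Root \<in> points W"
  "Tpt i j t \<in> points W \<longleftrightarrow> t \<in> W i j"
  by (auto simp: points_def)

lemma tiling_poset_iff:
  "(x, y) \<in> tiling_poset W \<longleftrightarrow> x \<in> points W \<and> y \<in> points W \<and>
     (x = Root \<or> y = x \<or> y \<in> succs x \<or> (\<exists>z\<in>succs x. y \<in> succs z))"
  by (auto simp: tiling_poset_def succs_rtrancl_iff)

text \<open>
  The horizontal (\<open>d = False\<close>) and vertical (\<open>d = True\<close>) parts of the poset are treated uniformly.
\<close>

definition max_pt :: "bool \<Rightarrow> bool \<Rightarrow> point" where "max_pt d i = (if d then Vpt i else Hpt i)"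
definition s_pt :: "bool \<Rightarrow> bool \<Rightarrow> point" where "s_pt d i = (if d then sV i else sH i)"
definition c_pt :: "bool \<Rightarrow> bool \<Rightarrow> point" where "c_pt d i = (if d then cV i else cH i)"
definition star_pt :: "bool \<Rightarrow> point" where "star_pt d = (if d then Sstar else Rstar)"
text \<open>The point for a step in direction \<open>d\<close> from parity \<open>i\<close> to
  parity \<open>\<not> i\<close>.\<close>

definition dir_pt :: "bool \<Rightarrow> bool \<Rightarrow> point" where "dir_pt d i = (if d then Sdir i else Rdir i)"

lemmas pt_defs = max_pt_def s_pt_def c_pt_def star_pt_def dir_pt_def Rdir_def Sdir_def

lemma pt_in_points [simp]:
  "max_pt d i \<in> points W" "s_pt d i \<in> points W" "c_pt d i \<in> points W"
  "star_pt d \<in> points W" "dir_pt d i \<in> points W"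
  by (auto simp: pt_defs)

lemma max_pt_inject [simp]: "max_pt d i = max_pt e j \<longleftrightarrow> d = e \<and> i = j"
  by (auto simp: pt_defs)

lemma max_pt_less_iff:
  assumes "p \<in> points W"
  shows "(p, max_pt e k) \<in> tiling_poset W \<longleftrightarrow>
    (case p of Hpt i \<Rightarrow> \<not> e \<and> k = i | Vpt j \<Rightarrow> e \<and> k = j
     | Tpt i j t \<Rightarrow> (if e then k = j else k = i)
     | sH i \<Rightarrow> \<not> e \<and> k = i | cH i \<Rightarrow> \<not> e \<and> k = i
     | sV i \<Rightarrow> e \<and> k = i | cV i \<Rightarrow> e \<and> k = i
     | Root \<Rightarrow> True
     | _ \<Rightarrow> (p \<in> {Sstar, S01, S10}) = e)"
  using assms by (cases p) (auto simp: tiling_poset_iff max_pt_def)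

lemma pt_below_max_pt_iff [simp]:
  "(max_pt d i, max_pt e j) \<in> tiling_poset W \<longleftrightarrow> e = d \<and> j = i"
  "(s_pt d i, max_pt e j) \<in> tiling_poset W \<longleftrightarrow> e = d \<and> j = i"
  "(c_pt d i, max_pt e j) \<in> tiling_poset W \<longleftrightarrow> e = d \<and> j = i"
  "(dir_pt d i, max_pt e j) \<in> tiling_poset W \<longleftrightarrow> e = d"
  by (cases d; cases e; auto simp: tiling_poset_iff pt_defs)+

text \<open>Each pair of maximal points is listed in one order only, whence the disjunction.\<close>

lemma tiling_domain_max_pt:
  assumes "(d, i) \<noteq> (e, j)"
  shows "({max_pt d i}, {max_pt e j}) \<in> tiling_domain W \<or> ({max_pt e j}, {max_pt d i}) \<in> tiling_domain W"
proof -
  have "({Hpt False}, {Hpt True}) \<in> tiling_domain W" "({Vpt False}, {Vpt True}) \<in> tiling_domain W"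
    unfolding tiling_domain_def by (rule UnI1, rule UnI1, rule UnI1, rule UnI1, simp)+
  moreover have "({Hpt i}, {Vpt j}) \<in> tiling_domain W" for i j
    unfolding tiling_domain_def by (rule UnI1, rule UnI1, rule UnI1, rule UnI2) simp
  ultimately show ?thesis
    using assms by (cases d; cases e; cases i; cases j) (simp_all add: max_pt_def)
qed

text \<open>Uniform form of the four pairs that force neighbours to exist.\<close>

lemma tiling_domain_successor:
  "(points W - {star_pt d, dir_pt d (\<not> i), dir_pt d i, Root},
    points W - {dir_pt d i, c_pt d (\<not> i), Root}) \<in> tiling_domain W"
proof -
  let ?c = "c_pt d (\<not> i)" and ?N = "{star_pt d, dir_pt d (\<not> i)}" and ?Q = "dir_pt d i"
  have "(?c, ?N, ?Q) \<in> {(cH True, {Rstar, R10}, R01), (cH False, {Rstar, R01}, R10),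
      (cV True, {Sstar, S10}, S01), (cV False, {Sstar, S01}, S10)}"
    by (cases d; cases i) (simp_all add: pt_defs)
  then have "(points W - (?N \<union> {?Q, Root}), points W - {?Q, ?c, Root}) \<in> tiling_domain W"
    unfolding tiling_domain_def
    by - (rule UnI1, rule UnI1, rule UnI2, rule CollectI, intro exI conjI, rule refl)
  moreover have "?N \<union> {?Q, Root} = {star_pt d, dir_pt d (\<not> i), dir_pt d i, Root}"
    "{?Q, ?c, Root} = {dir_pt d i, c_pt d (\<not> i), Root}" by auto
  ultimately show ?thesis by (simp only:)
qed

lemma tiling_domain_east:
  assumes "t \<in> W i j"
  shows "(points W - ({Tpt i j t, sH i, cH i, Root} \<union> east_matches W i j t),
    points W - ({Rdir i, sH i, cH i, Root} \<union> east_matches W i j t)) \<in> tiling_domain W"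
  unfolding tiling_domain_def
  by (rule UnI1, rule UnI2, rule CollectI, intro exI conjI, rule refl, rule assms)

lemma tiling_domain_north:
  assumes "t \<in> W i j"
  shows "(points W - ({Tpt i j t, sV j, cV j, Root} \<union> north_matches W i j t),
    points W - ({Sdir j, sV j, cV j, Root} \<union> north_matches W i j t)) \<in> tiling_domain W"
  unfolding tiling_domain_def
  by (rule UnI2, rule CollectI, intro exI conjI, rule refl, rule assms)

text \<open>By the pigeonhole principle the orbit of \<open>a\<close> repeats, and the earlier of
  two equal members is periodic.\<close>

lemma exists_cycle:
  assumes "finite A" "a \<in> A" "\<And>x. x \<in> A \<Longrightarrow> f x \<in> A"
  shows "\<exists>x\<in>A. \<exists>m>0. (f ^^ m) x = x"
proof -
  have mem: "(f ^^ n) a \<in> A" for n using assms by (induction n) auto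
  have "\<not> inj (\<lambda>n. (f ^^ n) a)"
  proof
    assume "inj (\<lambda>n. (f ^^ n) a)"
    then have "infinite (range (\<lambda>n. (f ^^ n) a))" by (simp add: finite_image_iff)
    then show False using mem assms(1) by (meson finite_subset image_subsetI)
  qed
  then obtain i j where ij: "(f ^^ i) a = (f ^^ j) a" "i < j"
    unfolding inj_def by (metis linorder_neqE_nat)
  have "(f ^^ (j - i)) ((f ^^ i) a) = (f ^^ (j - i + i)) a"
    by (simp only: funpow_add o_apply)
  then have "(f ^^ (j - i)) ((f ^^ i) a) = (f ^^ i) a" using ij by simp
  then show ?thesis using ij(2) mem by (meson zero_less_diff)
qed

text \<open>\<open>U\<close> is the point of the frame where the refutation takes place; all
  arguments below concern its non-empty subsets.\<close>

locale medvedev_refutation =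
  fixes W :: "bool \<Rightarrow> bool \<Rightarrow> tile set" and I U :: "'a set" and g :: "'a set \<Rightarrow> point set"
  assumes g: "refuting_map (medvedev_frame I) (tiling_poset W) (tiling_domain W) U g"
    and U: "U \<subseteq> I" "U \<noteq> {}"
begin

section \<open>The refuting map on subsets of \<open>U\<close>\<close>

abbreviation up :: "point \<Rightarrow> point set" where "up p \<equiv> tiling_poset W `` {p}"

lemma up_self: "p \<in> points W \<Longrightarrow> p \<in> up p"
  by (simp add: tiling_poset_iff)

lemma up_inject: "p \<in> points W \<Longrightarrow> q \<in> points W \<Longrightarrow> up p = up q \<Longrightarrow> p = q"
  using Partial_order_tiling_poset[of W] up_self
  by (metis ImageE antisymD partial_order_on_def singletonD)

lemma g_U: "g U = points W"
  using g by (simp add: refuting_map_def Field_tiling_poset)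

lemma
  assumes "X \<subseteq> U" "X \<noteq> {}"
  shows g_points: "g X \<subseteq> points W"
    and g_nonempty: "g X \<noteq> {}"
    and g_upset: "p \<in> g X \<Longrightarrow> (p, q) \<in> tiling_poset W \<Longrightarrow> q \<in> g X"
    and g_mono: "Y \<subseteq> X \<Longrightarrow> Y \<noteq> {} \<Longrightarrow> g Y \<subseteq> g X"
    and g_witness: "p \<in> g X \<Longrightarrow> \<exists>Y\<subseteq>X. Y \<noteq> {} \<and> g Y = up p"
    and g_domain: "(a, b) \<in> tiling_domain W \<Longrightarrow> g X \<subseteq> a \<union> b \<Longrightarrow> g X \<subseteq> a \<or> g X \<subseteq> b"
proof -
  have UX: "(U, X) \<in> medvedev_frame I"
    using U assms by (auto simp: medvedev_frame_def)
  have XY: "(X, Y) \<in> medvedev_frame I \<longleftrightarrow> Y \<subseteq> X \<and> Y \<noteq> {}" for Y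
    using U assms by (auto simp: medvedev_frame_def)
  have *: "g X \<in> Up (tiling_poset W)" "g X \<noteq> {}"
    "\<And>Y. (X, Y) \<in> medvedev_frame I \<Longrightarrow> g Y \<subseteq> g X"
    "\<And>p. p \<in> g X \<Longrightarrow> \<exists>Y. (X, Y) \<in> medvedev_frame I \<and> g Y = up p"
    "\<And>a b. (a, b) \<in> tiling_domain W \<Longrightarrow> g X \<subseteq> a \<union> b \<Longrightarrow> g X \<subseteq> a \<or> g X \<subseteq> b"
    using g[unfolded refuting_map_def, THEN conjunct2, rule_format, OF UX] by - (elim conjE; simp)+
  show "g X \<subseteq> points W" "p \<in> g X \<Longrightarrow> (p, q) \<in> tiling_poset W \<Longrightarrow> q \<in> g X"
    using *(1) by (auto simp: Up_def Field_tiling_poset)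
  show "Y \<subseteq> X \<Longrightarrow> Y \<noteq> {} \<Longrightarrow> g Y \<subseteq> g X" using *(3) by (simp add: XY)
  show "p \<in> g X \<Longrightarrow> \<exists>Y\<subseteq>X. Y \<noteq> {} \<and> g Y = up p" using *(4)[of p] unfolding XY by blast
  show "g X \<noteq> {}" by (fact *)
  show "(a, b) \<in> tiling_domain W \<Longrightarrow> g X \<subseteq> a \<union> b \<Longrightarrow> g X \<subseteq> a \<or> g X \<subseteq> b"
    by (fact *)
qed

text \<open>Pairs of complements act through this contrapositive: were \<open>A \<inter> B\<close>
  missed, \<open>g X\<close> would lie in the union of the complements and so avoid \<open>A\<close>
  or \<open>B\<close>.\<close>

lemma domain_hit:
  assumes "X \<subseteq> U" "X \<noteq> {}" "(points W - A, points W - B) \<in> tiling_domain W"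
    and "p \<in> A" "p \<in> g X" "q \<in> B" "q \<in> g X"
  shows "\<exists>r\<in>g X. r \<in> A \<and> r \<in> B"
  using g_domain[OF assms(1-3)] g_points[OF assms(1,2)] assms(4-) by blast

text \<open>The columns (\<open>d = False\<close>) or rows (\<open>d = True\<close>) of parity
  \<open>i\<close>.\<close>

definition col :: "bool \<Rightarrow> bool \<Rightarrow> 'a set" where
  "col d i = {a \<in> U. g {a} = {max_pt d i}}"

lemma col_subset: "col d i \<subseteq> U" by (auto simp: col_def)

lemma col_disjoint: "a \<in> col d i \<Longrightarrow> a \<in> col e j \<Longrightarrow> d = e \<and> i = j"
  by (auto simp: col_def)

lemma col_iff: "a \<in> col d i \<Longrightarrow> a \<in> col e j \<longleftrightarrow> e = d \<and> j = i"
  using col_disjoint by blast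

text \<open>A singleton has no proper non-empty subset, so \<open>g {a}\<close> is the principal
  upset of each of its points. By \<open>up_inject\<close> there is just one point, which is then
  maximal.\<close>

lemma exists_col:
  assumes "a \<in> U"
  shows "\<exists>d i. a \<in> col d i"
proof -
  have a: "{a} \<subseteq> U" "{a} \<noteq> {}" using assms by auto
  have eq: "g {a} = up p" if "p \<in> g {a}" for p
    using g_witness[OF a that] by (metis subset_singletonD)
  obtain p where p: "p \<in> g {a}" using g_nonempty[OF a] by blast
  have pp: "p \<in> points W" using p g_points[OF a] by blast
  have uniq: "q = p" if "q \<in> g {a}" for q
    using eq[OF p] eq[OF that] up_inject that g_points[OF a] pp by blast
  have "\<exists>d i. (p, max_pt d i) \<in> tiling_poset W"
    using pp by (cases p) (auto simp: max_pt_less_iff ex_bool_eq)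
  then obtain d i where "max_pt d i \<in> g {a}" using eq[OF p] by blast
  then have "g {a} = {max_pt d i}" using uniq by blast
  then show ?thesis using assms by (auto simp: col_def)
qed

text \<open>A subset realising a maximal point consists of elements whose singletons have that same
  image.\<close>

lemma max_pt_in_g_iff:
  assumes "X \<subseteq> U" "X \<noteq> {}"
  shows "max_pt d i \<in> g X \<longleftrightarrow> X \<inter> col d i \<noteq> {}"
proof
  assume "max_pt d i \<in> g X"
  then obtain Y where Y: "Y \<subseteq> X" "Y \<noteq> {}" "g Y = up (max_pt d i)"
    using g_witness[OF assms] by blast
  obtain a where a: "a \<in> Y" using Y(2) by blast
  then have aU: "a \<in> U" using Y(1) assms(1) by blast
  then obtain e j where ej: "a \<in> col e j" using exists_col by blast
  have "g {a} \<subseteq> g Y" by (rule g_mono) (use Y a assms in auto)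
  then have "(max_pt d i, max_pt e j) \<in> tiling_poset W" using ej Y(3) by (auto simp: col_def)
  then have "e = d \<and> j = i" by simp
  then show "X \<inter> col d i \<noteq> {}" using ej a Y(1) by blast
next
  assume "X \<inter> col d i \<noteq> {}"
  then obtain a where a: "a \<in> X" "g {a} = {max_pt d i}" by (auto simp: col_def)
  then show "max_pt d i \<in> g X" using g_mono[OF assms, of "{a}"] by simp
qed

lemma col_nonempty: "col d i \<noteq> {}"
  using max_pt_in_g_iff[of U d i] U(2) g_U by auto

lemma g_up_max_pt_iff:
  assumes "X \<subseteq> U" "X \<noteq> {}" "g X = up p"
  shows "(p, max_pt d i) \<in> tiling_poset W \<longleftrightarrow> X \<inter> col d i \<noteq> {}"
  using max_pt_in_g_iff[OF assms(1,2)] assms(3) by auto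

lemma Root_notin_g:
  assumes "X \<subseteq> U" "X \<noteq> {}" "X \<inter> col d i = {}"
  shows "Root \<notin> g X"
proof
  assume "Root \<in> g X"
  then have "max_pt d i \<in> g X" by (rule g_upset[OF assms(1,2)]) (simp add: tiling_poset_iff)
  then show False using max_pt_in_g_iff[OF assms(1,2)] assms(3) by blast
qed

text \<open>A subset realising \<open>s_pt d i\<close> lies within \<open>col d i\<close> and has at
  least two elements, as singletons go to maximal points.\<close>

lemma s_pt_notin_g:
  assumes "X \<subseteq> U" "X \<noteq> {}" "X \<inter> col d i \<subseteq> {a}"
  shows "s_pt d i \<notin> g X"
proof
  assume "s_pt d i \<in> g X"
  then obtain Y where Y: "Y \<subseteq> X" "Y \<noteq> {}" "g Y = up (s_pt d i)"
    using g_witness[OF assms(1,2)] by blast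
  have YU: "Y \<subseteq> U" using Y(1) assms(1) by blast
  have "b \<in> col d i" if b: "b \<in> Y" for b
  proof -
    obtain e j where "b \<in> col e j" using exists_col YU b by blast
    moreover from this have "(s_pt d i, max_pt e j) \<in> tiling_poset W"
      using g_up_max_pt_iff[OF YU Y(2,3)] b by blast
    then have "e = d \<and> j = i" by simp
    ultimately show ?thesis by simp
  qed
  then have "Y = {a}" "a \<in> col d i" using Y(1,2) assms(3) by blast+
  then have "up (s_pt d i) = {max_pt d i}" using Y(3) by (simp add: col_def)
  then show False using up_self[of "s_pt d i"] by (auto simp: pt_defs split: if_splits)
qed

lemma c_pt_notin_g:
  assumes "X \<subseteq> U" "X \<noteq> {}" "X \<inter> col d i \<subseteq> {a}"
  shows "c_pt d i \<notin> g X"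
proof
  have "(c_pt d i, s_pt d i) \<in> tiling_poset W"
    by (cases d) (simp_all add: tiling_poset_iff pt_defs)
  moreover assume "c_pt d i \<in> g X"
  ultimately have "s_pt d i \<in> g X" using g_upset[OF assms(1,2)] by blast
  then show False using s_pt_notin_g[OF assms] by blast
qed

text \<open>The domain pair for the two maximal points keeps \<open>g {a, b}\<close> from consisting
  of them alone. A further point can be realised only by \<open>{a, b}\<close> itself, as singletons
  go to maximal points, so it generates \<open>g {a, b}\<close>.\<close>

lemma pair_point:
  assumes a: "a \<in> col d i" and b: "b \<in> col e j" and ne: "(d, i) \<noteq> (e, j)"
  obtains p where "p \<in> points W" "g {a, b} = up p"
    "\<And>d' i'. (p, max_pt d' i') \<in> tiling_poset W \<longleftrightarrow> (d', i') = (d, i) \<or> (d', i') = (e, j)"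
proof -
  let ?X = "{a, b}"
  have X: "?X \<subseteq> U" "?X \<noteq> {}" using a b col_subset by auto
  have cols: "?X \<inter> col d' i' \<noteq> {} \<longleftrightarrow> (d', i') = (d, i) \<or> (d', i') = (e, j)" for d' i'
    using col_iff[OF a] col_iff[OF b] by auto
  have "\<exists>p\<in>g ?X. \<forall>d i. p \<noteq> max_pt d i"
  proof (rule ccontr)
    assume *: "\<not> (\<exists>p\<in>g ?X. \<forall>d i. p \<noteq> max_pt d i)"
    have sub: "g ?X \<subseteq> {max_pt d i} \<union> {max_pt e j}"
    proof
      fix p assume p: "p \<in> g ?X"
      with * obtain d' i' where "p = max_pt d' i'" by blast
      with p show "p \<in> {max_pt d i} \<union> {max_pt e j}" using max_pt_in_g_iff[OF X] cols by auto
    qed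
    have "g ?X \<subseteq> {max_pt d i} \<or> g ?X \<subseteq> {max_pt e j}"
      using tiling_domain_max_pt[OF ne, of W]
    proof
      assume "({max_pt d i}, {max_pt e j}) \<in> tiling_domain W"
      from g_domain[OF X this sub] show ?thesis .
    next
      assume "({max_pt e j}, {max_pt d i}) \<in> tiling_domain W"
      from g_domain[OF X this] sub show ?thesis by (simp add: Un_commute disj_commute)
    qed
    moreover have "max_pt d i \<in> g ?X" "max_pt e j \<in> g ?X"
      using max_pt_in_g_iff[OF X] a b by auto
    ultimately show False using ne by auto
  qed
  then obtain p where p: "p \<in> g ?X" "\<And>d i. p \<noteq> max_pt d i" by blast
  have pp: "p \<in> points W" using p(1) g_points[OF X] by blast
  obtain Y where Y: "Y \<subseteq> ?X" "Y \<noteq> {}" "g Y = up p" using g_witness[OF X p(1)] by blast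
  have "p \<in> g Y" using Y(3) up_self[OF pp] by blast
  then have "Y \<noteq> {a}" "Y \<noteq> {b}" using a b p(2) by (auto simp: col_def)
  then have "Y = ?X" using Y(1,2) by blast
  then have eq: "g ?X = up p" using Y(3) by simp
  show thesis by (rule that[OF pp eq]) (simp only: g_up_max_pt_iff[OF X eq] cols)
qed

text \<open>Only the star and step points lie below both maximal points of direction
  \<open>d\<close> without lying below the other two.\<close>

lemma pair_same_direction:
  assumes "a \<in> col d i" "b \<in> col d (\<not> i)"
  shows "\<exists>p\<in>{star_pt d, dir_pt d i, dir_pt d (\<not> i)}. g {a, b} = up p"
proof -
  obtain p where p: "p \<in> points W" "g {a, b} = up p"
    "\<And>d' i'. (p, max_pt d' i') \<in> tiling_poset W \<longleftrightarrow> (d', i') = (d, i) \<or> (d', i') = (d, \<not> i)"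
    by (rule pair_point[OF assms]) (simp, rule that)
  have *: "(p, max_pt d True) \<in> tiling_poset W" "(p, max_pt d False) \<in> tiling_poset W"
    "(p, max_pt (\<not> d) True) \<notin> tiling_poset W"
    unfolding p(3) by simp_all
  have "p \<in> {star_pt d, dir_pt d i, dir_pt d (\<not> i)}"
    using *[unfolded max_pt_less_iff[OF p(1)]]
    by (cases p; cases d; cases i) (simp_all add: pt_defs)
  then show ?thesis using p(2) by blast
qed

text \<open>Besides the root, only tile points lie below a maximal point of each direction; the root
  is excluded by \<open>Hpt (\<not> i)\<close>.\<close>

lemma pair_tile:
  assumes "a \<in> col False i" "b \<in> col True j"
  shows "\<exists>t\<in>W i j. g {a, b} = up (Tpt i j t)"
proof -
  obtain p where p: "p \<in> points W" "g {a, b} = up p"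
    "\<And>d' i'. (p, max_pt d' i') \<in> tiling_poset W \<longleftrightarrow> (d', i') = (False, i) \<or> (d', i') = (True, j)"
    by (rule pair_point[OF assms]) (simp, rule that)
  have *: "(p, max_pt False i) \<in> tiling_poset W" "(p, max_pt True j) \<in> tiling_poset W"
    "(p, max_pt False (\<not> i)) \<notin> tiling_poset W"
    unfolding p(3) by simp_all
  have "\<exists>t. p = Tpt i j t"
    using *[unfolded max_pt_less_iff[OF p(1)]] by (cases p) auto
  then show ?thesis using p(1,2) by auto
qed

text \<open>Realise \<open>c_pt d (\<not> i)\<close> by a set \<open>X\<close> of elements of parity
  \<open>\<not> i\<close> and add \<open>a\<close>. The image contains
  \<open>c_pt d (\<not> i)\<close> and a point spanned by \<open>a\<close> and an element of
  \<open>X\<close>, so the domain pair forces \<open>dir_pt d i\<close>, whose realisation must use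
  \<open>a\<close>.\<close>

lemma exists_successor:
  assumes a: "a \<in> col d i"
  shows "\<exists>b\<in>col d (\<not> i). g {a, b} = up (dir_pt d i)"
proof -
  have "c_pt d (\<not> i) \<in> g U" by (simp add: g_U)
  then obtain X where X: "X \<subseteq> U" "X \<noteq> {}" "g X = up (c_pt d (\<not> i))"
    using g_witness[of U] U(2) by blast
  have Xcol: "b \<in> col d (\<not> i)" if b: "b \<in> X" for b
  proof -
    obtain e j where "b \<in> col e j" using exists_col X(1) b by blast
    moreover from this have "(c_pt d (\<not> i), max_pt e j) \<in> tiling_poset W"
      using g_up_max_pt_iff[OF X] b by blast
    then have "e = d \<and> j = (\<not> i)" by simp
    ultimately show ?thesis by simp
  qed
  let ?X = "insert a X"
  have X': "?X \<subseteq> U" "?X \<noteq> {}" using X(1) a col_subset by auto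
  obtain b where b: "b \<in> X" using X(2) by blast
  obtain p where p: "p \<in> {star_pt d, dir_pt d i, dir_pt d (\<not> i)}" "g {a, b} = up p"
    using pair_same_direction[OF a Xcol[OF b]] by blast
  have "p \<in> points W" using p(1) by auto
  moreover have "g {a, b} \<subseteq> g ?X" by (rule g_mono[OF X']) (use b in auto)
  ultimately have pX: "p \<in> g ?X" using p(2) up_self by blast
  have "g X \<subseteq> g ?X" by (rule g_mono[OF X']) (use X(2) in auto)
  then have cX: "c_pt d (\<not> i) \<in> g ?X" using X(3) up_self[of "c_pt d (\<not> i)"] by auto
  have "\<exists>r\<in>g ?X. r \<in> {star_pt d, dir_pt d (\<not> i), dir_pt d i, Root}
      \<and> r \<in> {dir_pt d i, c_pt d (\<not> i), Root}"
    by (rule domain_hit[OF X' tiling_domain_successor _ pX _ cX]) (use p(1) in auto)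
  \<comment> \<open>All elements have direction \<open>d\<close>, which rules out the root as the
    common point.\<close>
  moreover have "?X \<inter> col (\<not> d) True = {}" using a Xcol col_disjoint by blast
  then have "Root \<notin> g ?X" by (rule Root_notin_g[OF X'])
  ultimately have "dir_pt d i \<in> g ?X" by (auto simp: pt_defs split: if_splits)
  then obtain Y where Y: "Y \<subseteq> ?X" "Y \<noteq> {}" "g Y = up (dir_pt d i)"
    using g_witness[OF X'] by blast
  have YU: "Y \<subseteq> U" using Y(1) X'(1) by blast
  have "(dir_pt d i, max_pt d k) \<in> tiling_poset W" for k
    by simp
  then have Yc: "Y \<inter> col d k \<noteq> {}" for k using g_up_max_pt_iff[OF YU Y(2,3)] by blast
  \<comment> \<open>\<open>a\<close> is the only element of parity \<open>i\<close> in
    \<open>insert a X\<close>.\<close>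
  have aY: "a \<in> Y" using Yc[of i] Y(1) Xcol col_disjoint by blast
  obtain b' where b': "b' \<in> Y" "b' \<in> col d (\<not> i)" using Yc[of "\<not> i"] by blast
  obtain q where q: "q \<in> {star_pt d, dir_pt d i, dir_pt d (\<not> i)}" "g {a, b'} = up q"
    using pair_same_direction[OF a b'(2)] by blast
  have "q \<in> points W" using q(1) by auto
  moreover have "g {a, b'} \<subseteq> g Y" by (rule g_mono[OF YU Y(2)]) (use b' aY in auto)
  ultimately have "(dir_pt d i, q) \<in> tiling_poset W" using q(2) Y(3) up_self by blast
  \<comment> \<open>The star and step points of one direction are pairwise incomparable.\<close>
  then have "q = dir_pt d i" using q(1) by (auto simp: tiling_poset_iff pt_defs split: if_splits)
  then show ?thesis using q(2) b'(2) by blast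
qed

text \<open>Choosing a successor for every element gives a self-map of the finite set of elements of
  direction \<open>d\<close>, and such a map has a cycle.\<close>

lemma exists_periodic_path:
  assumes "finite U"
  shows "\<exists>m>0. \<exists>\<alpha> :: nat \<Rightarrow> 'a. \<alpha> m = \<alpha> 0 \<and>
    (\<forall>k. \<exists>i. \<alpha> k \<in> col d i \<and> \<alpha> (Suc k) \<in> col d (\<not> i) \<and> g {\<alpha> k, \<alpha> (Suc k)} = up (dir_pt d i))"
proof -
  let ?R = "\<lambda>a b. \<exists>i. a \<in> col d i \<and> b \<in> col d (\<not> i) \<and> g {a, b} = up (dir_pt d i)"
  let ?A = "\<Union>i. col d i"
  have "\<forall>a\<in>?A. \<exists>b. ?R a b" using exists_successor by blast
  then obtain f where f: "\<And>a. a \<in> ?A \<Longrightarrow> ?R a (f a)" by metis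
  have fA: "f a \<in> ?A" if "a \<in> ?A" for a using f[OF that] by blast
  have "?A \<subseteq> U" using col_subset by blast
  then have fin: "finite ?A" using assms by (rule finite_subset)
  obtain a0 where "a0 \<in> col d True" using col_nonempty[of d True] by blast
  then have a0: "a0 \<in> ?A" by blast
  have "\<exists>a\<in>?A. \<exists>m>0. (f ^^ m) a = a" by (rule exists_cycle[OF fin a0 fA])
  then obtain a m where a: "a \<in> ?A" "m > 0" "(f ^^ m) a = a" by metis
  have A: "(f ^^ k) a \<in> ?A" for k by (induction k) (use a(1) fA in simp_all)
  have "?R ((f ^^ k) a) ((f ^^ Suc k) a)" for k using f[OF A[of k]] by simp
  then show ?thesis using a(2,3) by (intro exI[of _ m] conjI exI[of _ "\<lambda>k. (f ^^ k) a"]) simp_all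
qed

section \<open>Matching of adjacent tiles\<close>

lemma tile_point_cols:
  assumes Y: "Y \<subseteq> U" "Y \<noteq> {}" "g Y = up (Tpt i j t)" and t: "t \<in> W i j"
  shows "Y \<inter> col False k \<noteq> {} \<longleftrightarrow> k = i" "Y \<inter> col True k \<noteq> {} \<longleftrightarrow> k = j"
  using g_up_max_pt_iff[OF Y, of False k] g_up_max_pt_iff[OF Y, of True k] t
  by (auto simp: max_pt_less_iff)

text \<open>In the image of \<open>{a, a', b}\<close> the domain pair forces a point common to both
  removed sets. Having only one column of parity \<open>i\<close> excludes \<open>sH i\<close> and
  \<open>cH i\<close>, having no row of parity \<open>\<not> j\<close> excludes the root, so a
  matching tile point remains; its realisation must be \<open>{a', b}\<close>.\<close>

lemma east_step:
  assumes a: "a \<in> col False i" and a': "a' \<in> col False (\<not> i)" and b: "b \<in> col True j"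
    and r: "g {a, a'} = up (Rdir i)" and t: "t \<in> W i j" "g {a, b} = up (Tpt i j t)"
  shows "\<exists>t'\<in>W (\<not> i) j. east t = west t' \<and> g {a', b} = up (Tpt (\<not> i) j t')"
proof -
  let ?X = "{a, a', b}"
  have X: "?X \<subseteq> U" "?X \<noteq> {}" using a a' b col_subset by blast+
  have "Tpt i j t \<in> g ?X"
    using g_mono[OF X, of "{a, b}"] t up_self[of "Tpt i j t"] by auto
  moreover have "Rdir i \<in> g ?X"
    using g_mono[OF X, of "{a, a'}"] r up_self[of "Rdir i"] by (auto simp: Rdir_def)
  moreover note tiling_domain_east[of t W i j, OF t(1)]
  ultimately have "\<exists>r\<in>g ?X. r \<in> {Tpt i j t, sH i, cH i, Root} \<union> east_matches W i j t
      \<and> r \<in> {Rdir i, sH i, cH i, Root} \<union> east_matches W i j t"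
    by (intro domain_hit[OF X, of _ _ "Tpt i j t" "Rdir i"]) simp_all
  moreover have "?X \<inter> col False i \<subseteq> {a}" using a a' b col_disjoint by blast
  then have "s_pt False i \<notin> g ?X" "c_pt False i \<notin> g ?X"
    by (rule s_pt_notin_g[OF X], rule c_pt_notin_g[OF X])
  then have "sH i \<notin> g ?X" "cH i \<notin> g ?X" by (simp_all add: s_pt_def c_pt_def)
  moreover have "?X \<inter> col True (\<not> j) = {}" using a a' b col_disjoint by blast
  then have "Root \<notin> g ?X" by (rule Root_notin_g[OF X])
  moreover have "Tpt i j t \<noteq> Rdir i" by (simp add: Rdir_def)
  ultimately have "\<exists>r\<in>g ?X. r \<in> east_matches W i j t" by auto
  then obtain t' where t': "t' \<in> W (\<not> i) j" "east t = west t'" "Tpt (\<not> i) j t' \<in> g ?X"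
    by (auto simp: east_matches_def)
  obtain Y where Y: "Y \<subseteq> ?X" "Y \<noteq> {}" "g Y = up (Tpt (\<not> i) j t')"
    using g_witness[OF X t'(3)] by blast
  have YU: "Y \<subseteq> U" using Y(1) X(1) by blast
  note * = tile_point_cols[OF YU Y(2,3) t'(1)]
  have "a \<notin> Y" using *(1)[of i] a by blast
  moreover have "a' \<in> Y" using *(1)[of "\<not> i"] Y(1) a b col_disjoint by blast
  moreover have "b \<in> Y" using *(2)[of j] Y(1) a a' col_disjoint by blast
  ultimately have "Y = {a', b}" using Y(1) by blast
  then show ?thesis using t' Y(3) by blast
qed

text \<open>The argument of \<open>east_step\<close> with columns and rows interchanged.\<close>

lemma north_step:
  assumes b: "b \<in> col True j" and b': "b' \<in> col True (\<not> j)" and a: "a \<in> col False i"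
    and r: "g {b, b'} = up (Sdir j)" and t: "t \<in> W i j" "g {a, b} = up (Tpt i j t)"
  shows "\<exists>t'\<in>W i (\<not> j). north t = south t' \<and> g {a, b'} = up (Tpt i (\<not> j) t')"
proof -
  let ?X = "{b, b', a}"
  have X: "?X \<subseteq> U" "?X \<noteq> {}" using a b b' col_subset by blast+
  have "Tpt i j t \<in> g ?X"
    using g_mono[OF X, of "{a, b}"] t up_self[of "Tpt i j t"] by auto
  moreover have "Sdir j \<in> g ?X"
    using g_mono[OF X, of "{b, b'}"] r up_self[of "Sdir j"] by (auto simp: Sdir_def)
  moreover note tiling_domain_north[of t W i j, OF t(1)]
  ultimately have "\<exists>r\<in>g ?X. r \<in> {Tpt i j t, sV j, cV j, Root} \<union> north_matches W i j t
      \<and> r \<in> {Sdir j, sV j, cV j, Root} \<union> north_matches W i j t"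
    by (intro domain_hit[OF X, of _ _ "Tpt i j t" "Sdir j"]) simp_all
  moreover have "?X \<inter> col True j \<subseteq> {b}" using a b b' col_disjoint by blast
  then have "s_pt True j \<notin> g ?X" "c_pt True j \<notin> g ?X"
    by (rule s_pt_notin_g[OF X], rule c_pt_notin_g[OF X])
  then have "sV j \<notin> g ?X" "cV j \<notin> g ?X" by (simp_all add: s_pt_def c_pt_def)
  moreover have "?X \<inter> col False (\<not> i) = {}" using a b b' col_disjoint by blast
  then have "Root \<notin> g ?X" by (rule Root_notin_g[OF X])
  moreover have "Tpt i j t \<noteq> Sdir j" by (simp add: Sdir_def)
  ultimately have "\<exists>r\<in>g ?X. r \<in> north_matches W i j t" by auto
  then obtain t' where t': "t' \<in> W i (\<not> j)" "north t = south t'" "Tpt i (\<not> j) t' \<in> g ?X"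
    by (auto simp: north_matches_def)
  obtain Y where Y: "Y \<subseteq> ?X" "Y \<noteq> {}" "g Y = up (Tpt i (\<not> j) t')"
    using g_witness[OF X t'(3)] by blast
  have YU: "Y \<subseteq> U" using Y(1) X(1) by blast
  note * = tile_point_cols[OF YU Y(2,3) t'(1)]
  have "b \<notin> Y" using *(2)[of j] b by blast
  moreover have "b' \<in> Y" using *(2)[of "\<not> j"] Y(1) a b col_disjoint by blast
  moreover have "a \<in> Y" using *(1)[of i] Y(1) b b' col_disjoint by blast
  ultimately have "Y = {a, b'}" using Y(1) by blast
  then show ?thesis using t' Y(3) by blast
qed

lemma exists_periodic_tiling:
  assumes "finite U"
  shows "\<exists>m n \<tau>. periodic_tiling (\<Union>i j. W i j) m n \<tau>"
proof -
  obtain m \<alpha> where m: "m > 0" "\<alpha> m = \<alpha> 0" and \<alpha>: "\<And>k. \<exists>i. \<alpha> k \<in> col False i \<and>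
      \<alpha> (Suc k) \<in> col False (\<not> i) \<and> g {\<alpha> k, \<alpha> (Suc k)} = up (Rdir i)"
    using exists_periodic_path[OF assms, of False] by (auto simp: dir_pt_def)
  obtain n \<beta> where n: "n > 0" "\<beta> n = \<beta> 0" and \<beta>: "\<And>l. \<exists>j. \<beta> l \<in> col True j \<and>
      \<beta> (Suc l) \<in> col True (\<not> j) \<and> g {\<beta> l, \<beta> (Suc l)} = up (Sdir j)"
    using exists_periodic_path[OF assms, of True] by (auto simp: dir_pt_def)
  \<comment> \<open>The tile spanned by a column and a row; it is unique because principal upsets
    determine their generators.\<close>
  define T where "T a b = (SOME t. \<exists>i j. t \<in> W i j \<and> g {a, b} = up (Tpt i j t))" for a b
  have T: "T a b = t" if t: "t \<in> W i j" "g {a, b} = up (Tpt i j t)" for a b t i j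
  proof -
    have "\<exists>i j. T a b \<in> W i j \<and> g {a, b} = up (Tpt i j (T a b))"
      unfolding T_def by (rule someI[of _ t]) (use that in blast)
    then obtain i' j' where "T a b \<in> W i' j'" "up (Tpt i j t) = up (Tpt i' j' (T a b))"
      using t(2) by auto
    then show ?thesis using up_inject[of "Tpt i j t" "Tpt i' j' (T a b)"] t(1) by simp
  qed
  have *: "T (\<alpha> k) (\<beta> l) \<in> (\<Union>i j. W i j) \<and>
      east (T (\<alpha> k) (\<beta> l)) = west (T (\<alpha> (Suc k)) (\<beta> l)) \<and>
      north (T (\<alpha> k) (\<beta> l)) = south (T (\<alpha> k) (\<beta> (Suc l)))" for k l
  proof -
    obtain i where i: "\<alpha> k \<in> col False i" "\<alpha> (Suc k) \<in> col False (\<not> i)"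
      "g {\<alpha> k, \<alpha> (Suc k)} = up (Rdir i)" using \<alpha> by blast
    obtain j where j: "\<beta> l \<in> col True j" "\<beta> (Suc l) \<in> col True (\<not> j)"
      "g {\<beta> l, \<beta> (Suc l)} = up (Sdir j)" using \<beta> by blast
    obtain t where t: "t \<in> W i j" "g {\<alpha> k, \<beta> l} = up (Tpt i j t)"
      using pair_tile[OF i(1) j(1)] by blast
    show ?thesis
      using east_step[OF i(1,2) j(1) i(3) t] north_step[OF j(1,2) i(1) j(3) t] t T by auto
  qed
  \<comment> \<open>As the path closes up, reducing the index modulo its length changes
    nothing.\<close>
  have mod: "\<gamma> (Suc k mod m) = \<gamma> (Suc k)" if "k < m" "\<gamma> m = \<gamma> 0" for \<gamma> :: "nat \<Rightarrow> 'a" and k m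
    using that by (cases "Suc k = m") auto
  have "periodic_tiling (\<Union>i j. W i j) m n (\<lambda>k l. T (\<alpha> k) (\<beta> l))"
    using m n * by (simp add: periodic_tiling_def mod)
  then show ?thesis by blast
qed

end

section \<open>Membership in the logic of finite frames\<close>

lemma tiling_formula_in_Medvedev_logic:
  assumes "\<And>i j. finite (W i j)" "\<And>m n \<tau>. \<not> periodic_tiling (\<Union>i j. W i j) m n \<tau>"
  shows "tiling_formula W \<in> Medvedev_logic TYPE('a::infinite)"
proof (rule ccontr)
  assume "tiling_formula W \<notin> Medvedev_logic TYPE('a)"
  then obtain I :: "'a set" where I: "finite I" "\<not> valid (medvedev_frame I) (tiling_formula W)"
    by (auto simp: Medvedev_logic_def)
  have "\<exists>U g. U \<in> Field (medvedev_frame I) \<and>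
      refuting_map (medvedev_frame I) (tiling_poset W) (tiling_domain W) U g"
    by (rule refuting_map_if_not_valid)
      (fact Partial_order_tiling_poset Partial_order_medvedev_frame tiling_domain_subset
        I(2)[unfolded tiling_formula_def]
      | simp add: Field_tiling_poset finite_points assms(1) root_tiling_poset tiling_poset_iff)+
  then obtain U g where U: "U \<subseteq> I" "U \<noteq> {}"
    and g: "refuting_map (medvedev_frame I) (tiling_poset W) (tiling_domain W) U g"
    by (auto simp: Field_medvedev_frame)
  interpret medvedev_refutation W I U g by unfold_locales (use U g in auto)
  have "finite U" using U(1) I(1) finite_subset by blast
  then show False using exists_periodic_tiling assms(2) by blast
qed

section \<open>Plane tilings refute the formula in an infinite frame\<close>

text \<open>Preimages under \<open>e\<close> identify the two frames; this moves a refutation from a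
  concrete countable set into an arbitrary infinite type.\<close>

lemma refuting_map_medvedev_frame_embed:
  fixes e :: "'b \<Rightarrow> 'a"
  assumes g: "refuting_map (medvedev_frame UNIV) P D UNIV g" and e: "inj e"
  shows "refuting_map (medvedev_frame (range e)) P D (range e) (\<lambda>X. g (e -` X))"
proof -
  have up: "(UNIV, x) \<in> medvedev_frame UNIV \<longleftrightarrow> x \<noteq> {}" for x :: "'b set"
    by (auto simp: medvedev_frame_def)
  have gU: "g UNIV = Field P" using g by (simp add: refuting_map_def)
  note * = g[unfolded refuting_map_def up, THEN conjunct2, rule_format]
  note Up = *[THEN conjunct1] and nonempty = *[THEN conjunct2, THEN conjunct1]
    and mono = *[THEN conjunct2, THEN conjunct2, THEN conjunct1, rule_format]
    and wit = *[THEN conjunct2, THEN conjunct2, THEN conjunct2, THEN conjunct1, rule_format]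
    and dom = *[THEN conjunct2, THEN conjunct2, THEN conjunct2, THEN conjunct2, rule_format]
  have ne: "e -` X \<noteq> {}" if "(range e, X) \<in> medvedev_frame (range e)" for X
    using that by (auto simp: medvedev_frame_def)
  have vimage: "(e -` X, e -` Y) \<in> medvedev_frame UNIV"
    if "(X, Y) \<in> medvedev_frame (range e)" for X Y
    using that by (auto simp: medvedev_frame_def) blast+
  have image: "\<exists>Y. (X, Y) \<in> medvedev_frame (range e) \<and> e -` Y = y"
    if "(range e, X) \<in> medvedev_frame (range e)" "(e -` X, y) \<in> medvedev_frame UNIV" for X y
    using that e by (intro exI[of _ "e ` y"]) (auto simp: medvedev_frame_def inj_vimage_image_eq)
  show ?thesis
    unfolding refuting_map_def
  proof (intro conjI allI impI ballI)
    have "e -` range e = UNIV" by auto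
    then show "g (e -` range e) = Field P" using gU by simp
    fix X
    assume X: "(range e, X) \<in> medvedev_frame (range e)"
    show "g (e -` X) \<in> Up P" by (rule Up[OF ne[OF X]])
    show "g (e -` X) \<noteq> {}" by (rule nonempty[OF ne[OF X]])
    show "g (e -` Y) \<subseteq> g (e -` X)" if "(X, Y) \<in> medvedev_frame (range e)" for Y
      by (rule mono[OF ne[OF X] vimage[OF that]])
    show "\<exists>Y. (X, Y) \<in> medvedev_frame (range e) \<and> g (e -` Y) = P `` {p}"
      if "p \<in> g (e -` X)" for p
    proof -
      from wit[OF ne[OF X] that] obtain y where
        "(e -` X, y) \<in> medvedev_frame UNIV" "g y = P `` {p}" by (elim exE conjE)
      then show ?thesis using image[OF X] by metis
    qed
    show "g (e -` X) \<subseteq> a \<or> g (e -` X) \<subseteq> b"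
      if "(a, b) \<in> D" "g (e -` X) \<subseteq> a \<union> b" for a b
      by (rule dom[OF ne[OF X] that])
  qed
qed

text \<open>
  \<^term>\<open>Inl k\<close> and \<^term>\<open>Inr l\<close> stand for the columns and rows of the plane. The condition
  for \<open>sH i\<close> makes clause (iii) of the tiling domain hold: a set not supporting \<open>sH i\<close> has at
  most one column of parity \<open>i\<close>, so a tile and a step to the east that both start in columns
  of parity \<open>i\<close> start in the same column. The condition for \<open>cH\<close> makes clause (ii) hold.
\<close>

fun supports :: "(int \<Rightarrow> int \<Rightarrow> tile) \<Rightarrow> (int + int) set \<Rightarrow> point \<Rightarrow> bool" where
  "supports \<tau> X (Hpt i) \<longleftrightarrow> (\<exists>k. odd k = i \<and> Inl k \<in> X)"
| "supports \<tau> X (Vpt j) \<longleftrightarrow> (\<exists>l. odd l = j \<and> Inr l \<in> X)"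
| "supports \<tau> X Rstar \<longleftrightarrow> (\<exists>k k'. even k \<and> odd k' \<and> Inl k \<in> X \<and> Inl k' \<in> X \<and> k' \<noteq> k + 1 \<and> k \<noteq> k' + 1)"
| "supports \<tau> X R01 \<longleftrightarrow> (\<exists>k. even k \<and> Inl k \<in> X \<and> Inl (k + 1) \<in> X)"
| "supports \<tau> X R10 \<longleftrightarrow> (\<exists>k. odd k \<and> Inl k \<in> X \<and> Inl (k + 1) \<in> X)"
| "supports \<tau> X Sstar \<longleftrightarrow> (\<exists>l l'. even l \<and> odd l' \<and> Inr l \<in> X \<and> Inr l' \<in> X \<and> l' \<noteq> l + 1 \<and> l \<noteq> l' + 1)"
| "supports \<tau> X S01 \<longleftrightarrow> (\<exists>l. even l \<and> Inr l \<in> X \<and> Inr (l + 1) \<in> X)"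
| "supports \<tau> X S10 \<longleftrightarrow> (\<exists>l. odd l \<and> Inr l \<in> X \<and> Inr (l + 1) \<in> X)"
| "supports \<tau> X (Tpt i j t) \<longleftrightarrow> (\<exists>k l. odd k = i \<and> odd l = j \<and> Inl k \<in> X \<and> Inr l \<in> X \<and> \<tau> k l = t)"
| "supports \<tau> X (sH i) \<longleftrightarrow> (\<exists>k k'. odd k = i \<and> odd k' = i \<and> Inl k \<in> X \<and> Inl k' \<in> X \<and> k \<noteq> k')"
| "supports \<tau> X (sV j) \<longleftrightarrow> (\<exists>l l'. odd l = j \<and> odd l' = j \<and> Inr l \<in> X \<and> Inr l' \<in> X \<and> l \<noteq> l')"
| "supports \<tau> X (cH i) \<longleftrightarrow> (\<forall>k. odd k = i \<longrightarrow> Inl k \<in> X)"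
| "supports \<tau> X (cV j) \<longleftrightarrow> (\<forall>l. odd l = j \<longrightarrow> Inr l \<in> X)"
| "supports \<tau> X Root \<longleftrightarrow> X = UNIV"

lemma supports_mono: "supports \<tau> X p \<Longrightarrow> X \<subseteq> Y \<Longrightarrow> supports \<tau> Y p"
  by (cases p) (auto; blast)+

text \<open>Only tiles that occur at positions of these parities are taken, so that the whole plane
  supports every tile point.\<close>

definition tiles_at :: "(int \<Rightarrow> int \<Rightarrow> tile) \<Rightarrow> bool \<Rightarrow> bool \<Rightarrow> tile set" where
  "tiles_at \<tau> i j = {\<tau> k l | k l. odd k = i \<and> odd l = j}"

definition supported :: "(int \<Rightarrow> int \<Rightarrow> tile) \<Rightarrow> (int + int) set \<Rightarrow> point set" where
  "supported \<tau> X = {p \<in> points (tiles_at \<tau>). supports \<tau> X p}"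

section \<open>Supported points form upsets\<close>

lemma ex_parity: "\<exists>k::int. odd k = i"
  by (cases i) (auto intro: exI[of _ 0] exI[of _ 1])

lemma ex_parity_adjacent:
  fixes k :: int
  assumes "P k" "P (k + 1)"
  shows "\<exists>k. odd k = i \<and> P k"
proof (cases "odd k = i")
  case True
  then show ?thesis using assms(1) by blast
next
  case False
  then have "odd (k + 1) = i" by auto
  then show ?thesis using assms(2) by blast
qed

lemma supports_UNIV: "p \<in> points (tiles_at \<tau>) \<Longrightarrow> supports \<tau> UNIV p"
proof (cases p)
  case (sH i)
  obtain k :: int where "odd k = i" using ex_parity by blast
  then show ?thesis unfolding sH supports.simps
    by - (rule exI[of _ k], rule exI[of _ "k + 2"], simp)
next
  case (sV i)
  obtain k :: int where "odd k = i" using ex_parity by blast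
  then show ?thesis unfolding sV supports.simps
    by - (rule exI[of _ k], rule exI[of _ "k + 2"], simp)
next
  case Rstar
  \<comment> \<open>\<open>0\<close> and \<open>3\<close> differ in parity without being
    neighbours.\<close>
  show ?thesis unfolding Rstar supports.simps
    by (rule exI[of _ 0], rule exI[of _ 3]) simp
next
  case Sstar
  show ?thesis unfolding Sstar supports.simps
    by (rule exI[of _ 0], rule exI[of _ 3]) simp
qed (auto simp: tiles_at_def ex_parity intro: exI[of _ 0] exI[of _ 1])

text \<open>Two facts about parity suffice: a full parity class has two different members, and of
  two neighbours one has the parity sought.\<close>

lemma supports_succs:
  assumes "supports \<tau> X p" "q \<in> succs p"
  shows "supports \<tau> X q"
proof (cases p)
  case (cH i)
  obtain k :: int where "odd k = i" using ex_parity by blast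
  then have "supports \<tau> X (sH i)" using assms(1) unfolding cH supports.simps
    by - (rule exI[of _ k], rule exI[of _ "k + 2"], simp)
  then show ?thesis using assms(2) cH by simp
next
  case (cV i)
  obtain k :: int where "odd k = i" using ex_parity by blast
  then have "supports \<tau> X (sV i)" using assms(1) unfolding cV supports.simps
    by - (rule exI[of _ k], rule exI[of _ "k + 2"], simp)
  then show ?thesis using assms(2) cV by simp
next
  case R01
  then obtain k where "Inl k \<in> X" "Inl (k + 1) \<in> X" using assms by auto
  then have "supports \<tau> X (Hpt i)" for i
    unfolding supports.simps by - (rule ex_parity_adjacent, assumption, assumption)
  then show ?thesis using assms(2) R01 by (auto simp del: supports.simps)
next
  case R10
  then obtain k where "Inl k \<in> X" "Inl (k + 1) \<in> X" using assms by auto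
  then have "supports \<tau> X (Hpt i)" for i
    unfolding supports.simps by - (rule ex_parity_adjacent, assumption, assumption)
  then show ?thesis using assms(2) R10 by (auto simp del: supports.simps)
next
  case S01
  then obtain k where "Inr k \<in> X" "Inr (k + 1) \<in> X" using assms by auto
  then have "supports \<tau> X (Vpt i)" for i
    unfolding supports.simps by - (rule ex_parity_adjacent, assumption, assumption)
  then show ?thesis using assms(2) S01 by (auto simp del: supports.simps)
next
  case S10
  then obtain k where "Inr k \<in> X" "Inr (k + 1) \<in> X" using assms by auto
  then have "supports \<tau> X (Vpt i)" for i
    unfolding supports.simps by - (rule ex_parity_adjacent, assumption, assumption)
  then show ?thesis using assms(2) S10 by (auto simp del: supports.simps)
next
  case Rstar
  then have "supports \<tau> X (Hpt i)" for i using assms(1) by (cases i) auto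
  then show ?thesis using assms(2) Rstar by (auto simp del: supports.simps)
next
  case Sstar
  then have "supports \<tau> X (Vpt i)" for i using assms(1) by (cases i) auto
  then show ?thesis using assms(2) Sstar by (auto simp del: supports.simps)
qed (use assms in auto)

lemma supported_Up: "supported \<tau> X \<in> Up (tiling_poset (tiles_at \<tau>))"
proof -
  have "q \<in> supported \<tau> X" if "p \<in> supported \<tau> X" "(p, q) \<in> tiling_poset (tiles_at \<tau>)" for p q
  proof -
    from that have "q \<in> points (tiles_at \<tau>)" "supports \<tau> X p"
      by (auto simp: supported_def tiling_poset_iff)
    moreover from that(2) have "p = Root \<or> q = p \<or> q \<in> succs p \<or> (\<exists>z\<in>succs p. q \<in> succs z)"
      by (simp add: tiling_poset_iff)
    ultimately show ?thesis
      using supports_succs[of \<tau> X] supports_UNIV[of q \<tau>] by (auto simp: supported_def)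
  qed
  moreover have "supported \<tau> X \<subseteq> points (tiles_at \<tau>)" by (auto simp: supported_def)
  ultimately show ?thesis unfolding Up_def Field_tiling_poset by blast
qed

lemma supported_UNIV: "supported \<tau> UNIV = points (tiles_at \<tau>)"
  using supports_UNIV by (auto simp: supported_def)

lemma supported_nonempty: "X \<noteq> {} \<Longrightarrow> supported \<tau> X \<noteq> {}"
proof -
  assume "X \<noteq> {}"
  then obtain x where x: "x \<in> X" by blast
  show ?thesis
  proof (cases x)
    case (Inl k)
    then have "Hpt (odd k) \<in> supported \<tau> X" using x by (auto simp: supported_def)
    then show ?thesis by blast
  next
    case (Inr l)
    then have "Vpt (odd l) \<in> supported \<tau> X" using x by (auto simp: supported_def)
    then show ?thesis by blast
  qed
qed

section \<open>Realisation of single points\<close>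

lemma infinite_parity: "infinite {k :: int. odd k = i}"
proof
  assume fin: "finite {k :: int. odd k = i}"
  have "inj (\<lambda>n. 2 * n + (if i then 1 else 0) :: int)" by (auto simp: inj_def)
  moreover have "range (\<lambda>n. 2 * n + (if i then 1 else 0) :: int) \<subseteq> {k. odd k = i}" by auto
  ultimately show False using fin infinite_UNIV_int by (meson finite_imageD finite_subset)
qed

text \<open>Here infinity enters: finite sets support none of the points that only infinite sets
  should realise.\<close>

lemma not_supports_finite:
  assumes "finite X"
  shows "\<not> supports \<tau> X (cH i)" "\<not> supports \<tau> X (cV i)" "\<not> supports \<tau> X Root"
proof -
  have "finite (Inl -` X)" "finite (Inr -` X)"
    using assms by (simp_all add: finite_vimageI)
  then have "\<not> {k. odd k = i} \<subseteq> Inl -` X" "\<not> {k. odd k = i} \<subseteq> Inr -` X"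
    using infinite_parity[of i] finite_subset by blast+
  then show "\<not> supports \<tau> X (cH i)" "\<not> supports \<tau> X (cV i)" by auto
  have "infinite (UNIV :: (int + int) set)"
    by (metis finite_Plus_UNIV_iff infinite_UNIV_int)
  then show "\<not> supports \<tau> X Root" using assms by auto
qed

lemma supported_eq_up:
  assumes "p \<in> points (tiles_at \<tau>)" "supports \<tau> Y p"
    and "\<And>q. q \<in> points (tiles_at \<tau>) \<Longrightarrow> supports \<tau> Y q \<Longrightarrow> (p, q) \<in> tiling_poset (tiles_at \<tau>)"
  shows "supported \<tau> Y = tiling_poset (tiles_at \<tau>) `` {p}"
proof
  show "tiling_poset (tiles_at \<tau>) `` {p} \<subseteq> supported \<tau> Y"
    using assms(1,2) supported_Up[of \<tau> Y] by (auto simp: Up_def supported_def)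
qed (use assms(3) in \<open>auto simp: supported_def\<close>)

text \<open>Take just the elements that make \<open>p\<close> supported: at most two columns or rows
  for most \<open>p\<close>, a full parity class for \<open>cH\<close> and \<open>cV\<close>,
  everything for the root. Nothing outside the principal upset of \<open>p\<close> is then
  supported.\<close>

lemma exists_minimal_support:
  assumes p: "p \<in> points (tiles_at \<tau>)" "supports \<tau> X p"
  shows "\<exists>Y\<subseteq>X. Y \<noteq> {} \<and> supported \<tau> Y = tiling_poset (tiles_at \<tau>) `` {p}"
proof -
  have *: ?thesis if "Y \<subseteq> X" "Y \<noteq> {}" "supports \<tau> Y p"
    "\<And>q. q \<in> points (tiles_at \<tau>) \<Longrightarrow> supports \<tau> Y q \<Longrightarrow> (p, q) \<in> tiling_poset (tiles_at \<tau>)" for Y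
    using that supported_eq_up[OF p(1)] by metis
  \<comment> \<open>A finite \<open>Y\<close> supports neither the root nor any \<open>cH\<close> or
    \<open>cV\<close>, so these may be left out of the comparison.\<close>
  have small: ?thesis if "Y \<subseteq> X" "Y \<noteq> {}" "finite Y" "supports \<tau> Y p"
    "\<And>q. supports \<tau> Y q \<Longrightarrow> q = p \<or> q \<in> succs p \<or> (\<exists>z\<in>succs p. q \<in> succs z)
      \<or> q = Root \<or> q \<in> range cH \<or> q \<in> range cV"
    for Y
  proof (rule *[OF that(1,2,4)])
    fix q assume q: "q \<in> points (tiles_at \<tau>)" "supports \<tau> Y q"
    have "q \<noteq> Root" "q \<notin> range cH" "q \<notin> range cV"
      using q(2) not_supports_finite[OF that(3)] by blast+
    then show "(p, q) \<in> tiling_poset (tiles_at \<tau>)"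
      using that(5)[OF q(2)] q(1) p(1) by (simp add: tiling_poset_iff)
  qed
  show ?thesis
  proof (cases p)
    case (Hpt i)
    then obtain k where "odd k = i" "Inl k \<in> X" using p(2) by auto
    then show ?thesis using Hpt by (intro small[of "{Inl k}"]; auto; case_tac q; auto)
  next
    case (Vpt i)
    then obtain k where "odd k = i" "Inr k \<in> X" using p(2) by auto
    then show ?thesis using Vpt by (intro small[of "{Inr k}"]; auto; case_tac q; auto)
  next
    case Rstar
    then obtain k k' where "even k" "odd k'" "Inl k \<in> X" "Inl k' \<in> X" "k' \<noteq> k + 1" "k \<noteq> k' + 1"
      using p(2) by auto
    then show ?thesis using Rstar by (intro small[of "{Inl k, Inl k'}"]; auto; case_tac q; auto)
  next
    case Sstar
    then obtain k k' where "even k" "odd k'" "Inr k \<in> X" "Inr k' \<in> X" "k' \<noteq> k + 1" "k \<noteq> k' + 1"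
      using p(2) by auto
    then show ?thesis using Sstar by (intro small[of "{Inr k, Inr k'}"]; auto; case_tac q; auto)
  next
    case R01
    then obtain k where "even k" "Inl k \<in> X" "Inl (k + 1) \<in> X" using p(2) by auto
    then show ?thesis using R01 by (intro small[of "{Inl k, Inl (k + 1)}"]; auto; case_tac q; auto)
  next
    case R10
    then obtain k where "odd k" "Inl k \<in> X" "Inl (k + 1) \<in> X" using p(2) by auto
    then show ?thesis using R10 by (intro small[of "{Inl k, Inl (k + 1)}"]; auto; case_tac q; auto)
  next
    case S01
    then obtain k where "even k" "Inr k \<in> X" "Inr (k + 1) \<in> X" using p(2) by auto
    then show ?thesis using S01 by (intro small[of "{Inr k, Inr (k + 1)}"]; auto; case_tac q; auto)
  next
    case S10
    then obtain k where "odd k" "Inr k \<in> X" "Inr (k + 1) \<in> X" using p(2) by auto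
    then show ?thesis using S10 by (intro small[of "{Inr k, Inr (k + 1)}"]; auto; case_tac q; auto)
  next
    case (Tpt i j t)
    then obtain k l where kl: "i = odd k" "j = odd l" "t = \<tau> k l" "Inl k \<in> X" "Inr l \<in> X"
      using p(2) by auto
    show ?thesis
    proof (rule small[of "{Inl k, Inr l}"])
      fix q assume "supports \<tau> {Inl k, Inr l} q"
      then show "q = p \<or> q \<in> succs p \<or> (\<exists>z\<in>succs p. q \<in> succs z)
          \<or> q = Root \<or> q \<in> range cH \<or> q \<in> range cV"
        unfolding Tpt kl(1-3) by (cases q) auto
    qed (use Tpt kl in simp_all)
  next
    case (sH i)
    then obtain k k' where "odd k = i" "odd k' = i" "Inl k \<in> X" "Inl k' \<in> X" "k \<noteq> k'"
      using p(2) by auto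
    then show ?thesis using sH by (intro small[of "{Inl k, Inl k'}"]; auto; case_tac q; auto)
  next
    case (sV i)
    then obtain k k' where "odd k = i" "odd k' = i" "Inr k \<in> X" "Inr k' \<in> X" "k \<noteq> k'"
      using p(2) by auto
    then show ?thesis using sV by (intro small[of "{Inr k, Inr k'}"]; auto; case_tac q; auto)
  next
    case (cH i)
    let ?Y = "Inl ` {k. odd k = i} :: (int + int) set"
    have "?Y \<subseteq> X" "?Y \<noteq> {}" using p(2) cH ex_parity[of i] by auto
    moreover have "(p, q) \<in> tiling_poset (tiles_at \<tau>)"
      if q: "q \<in> points (tiles_at \<tau>)" "supports \<tau> ?Y q" for q
      using q cH ex_parity by (cases q) (auto simp: tiling_poset_iff image_iff)
    ultimately show ?thesis using cH by (intro *[of ?Y]) auto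
  next
    case (cV i)
    let ?Y = "Inr ` {k. odd k = i} :: (int + int) set"
    have "?Y \<subseteq> X" "?Y \<noteq> {}" using p(2) cV ex_parity[of i] by auto
    moreover have "(p, q) \<in> tiling_poset (tiles_at \<tau>)"
      if q: "q \<in> points (tiles_at \<tau>)" "supports \<tau> ?Y q" for q
      using q cV ex_parity by (cases q) (auto simp: tiling_poset_iff image_iff)
    ultimately show ?thesis using cV by (intro *[of ?Y]) auto
  next
    case Root
    then show ?thesis using p(2) by (intro *[of UNIV]) (auto simp: tiling_poset_iff)
  qed
qed

section \<open>Supported points respect the tiling domain\<close>

lemma supports_adjacent:
  assumes "even k" "odd k'"
  shows "Inl k \<in> X \<Longrightarrow> Inl k' \<in> X \<Longrightarrow> supports \<tau> X R01 \<or> supports \<tau> X R10 \<or> supports \<tau> X Rstar"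
    and "Inr k \<in> X \<Longrightarrow> Inr k' \<in> X \<Longrightarrow> supports \<tau> X S01 \<or> supports \<tau> X S10 \<or> supports \<tau> X Sstar"
  using assms unfolding supports.simps
  by (cases "k' = k + 1"; cases "k = k' + 1"; blast)+

text \<open>If everything of parity \<open>\<not> i\<close> is present, so is the neighbour
  \<open>k + 1\<close> of any \<open>k\<close> of parity \<open>i\<close>.\<close>

lemma supports_dir:
  shows "supports \<tau> X (cH (\<not> i)) \<Longrightarrow> supports \<tau> X (Hpt i) \<Longrightarrow> supports \<tau> X (Rdir i)"
    and "supports \<tau> X (cV (\<not> i)) \<Longrightarrow> supports \<tau> X (Vpt i) \<Longrightarrow> supports \<tau> X (Sdir i)"
proof -
  assume X: "supports \<tau> X (cH (\<not> i))" "supports \<tau> X (Hpt i)"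
  from X(2) obtain k where k: "odd k = i" "Inl k \<in> X" by auto
  then have "Inl (k + 1) \<in> X" using X(1) by auto
  then show "supports \<tau> X (Rdir i)" using k by (cases i) (auto simp: Rdir_def)
next
  assume X: "supports \<tau> X (cV (\<not> i))" "supports \<tau> X (Vpt i)"
  from X(2) obtain k where k: "odd k = i" "Inr k \<in> X" by auto
  then have "Inr (k + 1) \<in> X" using X(1) by auto
  then show "supports \<tau> X (Sdir i)" using k by (cases i) (auto simp: Sdir_def)
qed

text \<open>The counterpart of \<open>domain_hit\<close>: it suffices to find a supported point
  common to \<open>A\<close> and \<open>B\<close>.\<close>

lemma supported_domain_diff:
  assumes "\<And>p q. p \<in> A \<Longrightarrow> q \<in> B \<Longrightarrow> supports \<tau> X p \<Longrightarrow> supports \<tau> X q \<Longrightarrow>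
      \<exists>r\<in>points (tiles_at \<tau>). r \<in> A \<and> r \<in> B \<and> supports \<tau> X r"
    and "supported \<tau> X \<subseteq> (points (tiles_at \<tau>) - A) \<union> (points (tiles_at \<tau>) - B)"
  shows "supported \<tau> X \<subseteq> points (tiles_at \<tau>) - A \<or> supported \<tau> X \<subseteq> points (tiles_at \<tau>) - B"
proof (rule ccontr)
  assume "\<not> ?thesis"
  then obtain p q where "p \<in> A" "supports \<tau> X p" "q \<in> B" "supports \<tau> X q"
    by (auto simp: supported_def)
  with assms(1) obtain r where "r \<in> points (tiles_at \<tau>)" "r \<in> A" "r \<in> B" "supports \<tau> X r" by meson
  then show False using assms(2) by (auto simp: supported_def)
qed

text \<open>Each kind of pair is settled by a point that must also be supported: one spanned by two
  maximal points, a step to a neighbour, or a matching tile.\<close>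

lemma supported_domain:
  assumes \<tau>: "plane_tiling T \<tau>" and ab: "(a, b) \<in> tiling_domain (tiles_at \<tau>)"
    and sub: "supported \<tau> X \<subseteq> a \<union> b"
  shows "supported \<tau> X \<subseteq> a \<or> supported \<tau> X \<subseteq> b"
proof -
  let ?P = "points (tiles_at \<tau>)"
  have east: "east (\<tau> k l) = west (\<tau> (k + 1) l)" and north: "north (\<tau> k l) = south (\<tau> k (l + 1))"
    for k l using \<tau> by (auto simp: plane_tiling_def)
  have in_tiles: "\<tau> k l \<in> tiles_at \<tau> (odd k) (odd l)" for k l by (auto simp: tiles_at_def)
  have mem: "p \<in> a \<union> b" if "p \<in> ?P" "supports \<tau> X p" for p
    using sub that by (auto simp: supported_def)
  have singletons: ?thesis if "a = {p}" "b = {q}" "\<not> (supports \<tau> X p \<and> supports \<tau> X q)" for p q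
  proof -
    have "p \<notin> supported \<tau> X \<or> q \<notin> supported \<tau> X" using that(3) by (simp add: supported_def)
    then show ?thesis using sub that(1,2) by blast
  qed
  from ab[unfolded tiling_domain_def] show ?thesis
  proof (elim UnE)
    assume "(a, b) \<in> {({Hpt False}, {Hpt True}), ({Vpt False}, {Vpt True})}"
    then consider (HH) "a = {Hpt False}" "b = {Hpt True}" | (VV) "a = {Vpt False}" "b = {Vpt True}"
      by auto
    then show ?thesis
    proof cases
      case HH
      have "\<not> (supports \<tau> X (Hpt False) \<and> supports \<tau> X (Hpt True))"
      proof
        assume "supports \<tau> X (Hpt False) \<and> supports \<tau> X (Hpt True)"
        then have "supports \<tau> X R01 \<or> supports \<tau> X R10 \<or> supports \<tau> X Rstar"
          using supports_adjacent(1) by auto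
        \<comment> \<open>None of the three points lies in \<open>a\<close> or
          \<open>b\<close>.\<close>
        then show False using mem[of R01] mem[of R10] mem[of Rstar] HH by auto
      qed
      then show ?thesis by (rule singletons[OF HH])
    next
      case VV
      have "\<not> (supports \<tau> X (Vpt False) \<and> supports \<tau> X (Vpt True))"
      proof
        assume "supports \<tau> X (Vpt False) \<and> supports \<tau> X (Vpt True)"
        then have "supports \<tau> X S01 \<or> supports \<tau> X S10 \<or> supports \<tau> X Sstar"
          using supports_adjacent(2) by auto
        then show False using mem[of S01] mem[of S10] mem[of Sstar] VV by auto
      qed
      then show ?thesis by (rule singletons[OF VV])
    qed
  next
    assume "(a, b) \<in> {({Hpt i}, {Vpt j}) | i j. True}"
    then obtain i j where HV: "a = {Hpt i}" "b = {Vpt j}" by auto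
    have "\<not> (supports \<tau> X (Hpt i) \<and> supports \<tau> X (Vpt j))"
    proof
      assume "supports \<tau> X (Hpt i) \<and> supports \<tau> X (Vpt j)"
      then obtain k l where "odd k = i" "odd l = j" "Inl k \<in> X" "Inr l \<in> X" by auto
      then show False using mem[of "Tpt i j (\<tau> k l)"] in_tiles[of k l] HV by auto
    qed
    then show ?thesis by (rule singletons[OF HV])
  next
    let ?S = "{(cH True, {Rstar, R10}, R01), (cH False, {Rstar, R01}, R10),
                      (cV True, {Sstar, S10}, S01), (cV False, {Sstar, S01}, S10)}"
    assume "(a, b) \<in> {(?P - (N \<union> {Q, Root}), ?P - {Q, c, Root}) | c N Q. (c, N, Q) \<in> ?S}"
    then obtain c N Q where succ: "a = ?P - (N \<union> {Q, Root})" "b = ?P - {Q, c, Root}" "(c, N, Q) \<in> ?S"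
      by (elim CollectE exE conjE Pair_inject) (rule that)
    \<comment> \<open>Each \<open>p\<close> in \<open>N\<close> lies below the maximal point of the
      parity where \<open>Q\<close> starts, so \<open>supports_dir\<close> applies.\<close>
    have *: "supports \<tau> X Q" if "supports \<tau> X c" "p \<in> N" "supports \<tau> X p" for p
    proof -
      have "(\<exists>i. c = cH (\<not> i) \<and> Q = Rdir i \<and> Hpt i \<in> succs p)
          \<or> (\<exists>i. c = cV (\<not> i) \<and> Q = Sdir i \<and> Vpt i \<in> succs p)"
        using succ(3) that(2) by (auto simp: Rdir_def Sdir_def ex_bool_eq)
      then show ?thesis using supports_dir supports_succs that(1,3) by metis
    qed
    have "Q \<in> ?P" using succ(3) by auto
    with * show ?thesis using sub unfolding succ(1,2)
      by (intro supported_domain_diff) auto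
  next
    assume "(a, b) \<in> {(?P - ({Tpt i j t, sH i, cH i, Root} \<union> east_matches (tiles_at \<tau>) i j t),
       ?P - ({Rdir i, sH i, cH i, Root} \<union> east_matches (tiles_at \<tau>) i j t)) | i j t. t \<in> tiles_at \<tau> i j}"
    then obtain i j t where ab: "a = ?P - ({Tpt i j t, sH i, cH i, Root} \<union> east_matches (tiles_at \<tau>) i j t)"
      "b = ?P - ({Rdir i, sH i, cH i, Root} \<union> east_matches (tiles_at \<tau>) i j t)"
      by (elim CollectE exE conjE Pair_inject) (rule that)
    show ?thesis using sub unfolding ab
    proof (rule supported_domain_diff[rotated])
      fix p q
      let ?G = "east_matches (tiles_at \<tau>) i j t"
      assume p: "p \<in> {Tpt i j t, sH i, cH i, Root} \<union> ?G" "supports \<tau> X p"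
        and q: "q \<in> {Rdir i, sH i, cH i, Root} \<union> ?G" "supports \<tau> X q"
      let ?goal = "\<exists>r\<in>?P. r \<in> {Tpt i j t, sH i, cH i, Root} \<union> ?G
        \<and> r \<in> {Rdir i, sH i, cH i, Root} \<union> ?G \<and> supports \<tau> X r"
      have common: ?goal if "r \<in> {sH i, cH i, Root} \<union> ?G" "supports \<tau> X r" for r
        using that by (intro bexI[of _ r]) (auto simp: east_matches_def)
      show ?goal
      proof (cases "p = Tpt i j t \<and> q = Rdir i")
        case True
        then obtain k l where kl: "odd k = i" "odd l = j" "Inl k \<in> X" "Inr l \<in> X" "\<tau> k l = t"
          using p(2) by auto
        obtain k' where k': "odd k' = i" "Inl k' \<in> X" "Inl (k' + 1) \<in> X"
          using True q(2) by (auto simp: Rdir_def split: if_splits)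
        \<comment> \<open>If tile and step start in the same column, the tile to the east is the
          common point; otherwise two columns of parity \<open>i\<close> support
          \<open>sH i\<close>.\<close>
        show ?thesis
        proof (cases "k' = k")
          case True
          have "Tpt (\<not> i) j (\<tau> (k + 1) l) \<in> ?G"
            using kl east[of k l] in_tiles[of "k + 1" l] by (auto simp: east_matches_def)
          moreover have "supports \<tau> X (Tpt (\<not> i) j (\<tau> (k + 1) l))"
            unfolding supports.simps using kl k' True
            by - (rule exI[of _ "k + 1"], rule exI[of _ l], auto)
          ultimately show ?thesis by (intro common UnI2)
        next
          case False
          then have "supports \<tau> X (sH i)" using kl k' by auto
          then show ?thesis by (intro common[of "sH i"]) simp_all
        qed
      next
        case False
        then show ?thesis using p q common by blast
      qed
    qed
  next
    assume "(a, b) \<in> {(?P - ({Tpt i j t, sV j, cV j, Root} \<union> north_matches (tiles_at \<tau>) i j t),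
       ?P - ({Sdir j, sV j, cV j, Root} \<union> north_matches (tiles_at \<tau>) i j t)) | i j t. t \<in> tiles_at \<tau> i j}"
    then obtain i j t where ab: "a = ?P - ({Tpt i j t, sV j, cV j, Root} \<union> north_matches (tiles_at \<tau>) i j t)"
      "b = ?P - ({Sdir j, sV j, cV j, Root} \<union> north_matches (tiles_at \<tau>) i j t)"
      by (elim CollectE exE conjE Pair_inject) (rule that)
    show ?thesis using sub unfolding ab
    proof (rule supported_domain_diff[rotated])
      fix p q
      let ?G = "north_matches (tiles_at \<tau>) i j t"
      assume p: "p \<in> {Tpt i j t, sV j, cV j, Root} \<union> ?G" "supports \<tau> X p"
        and q: "q \<in> {Sdir j, sV j, cV j, Root} \<union> ?G" "supports \<tau> X q"
      let ?goal = "\<exists>r\<in>?P. r \<in> {Tpt i j t, sV j, cV j, Root} \<union> ?G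
        \<and> r \<in> {Sdir j, sV j, cV j, Root} \<union> ?G \<and> supports \<tau> X r"
      have common: ?goal if "r \<in> {sV j, cV j, Root} \<union> ?G" "supports \<tau> X r" for r
        using that by (intro bexI[of _ r]) (auto simp: north_matches_def)
      show ?goal
      proof (cases "p = Tpt i j t \<and> q = Sdir j")
        case True
        then obtain k l where kl: "odd k = i" "odd l = j" "Inl k \<in> X" "Inr l \<in> X" "\<tau> k l = t"
          using p(2) by auto
        obtain l' where l': "odd l' = j" "Inr l' \<in> X" "Inr (l' + 1) \<in> X"
          using True q(2) by (auto simp: Sdir_def split: if_splits)
        show ?thesis
        proof (cases "l' = l")
          case True
          have "Tpt i (\<not> j) (\<tau> k (l + 1)) \<in> ?G"
            using kl north[of k l] in_tiles[of k "l + 1"] by (auto simp: north_matches_def)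
          moreover have "supports \<tau> X (Tpt i (\<not> j) (\<tau> k (l + 1)))"
            unfolding supports.simps using kl l' True
            by - (rule exI[of _ k], rule exI[of _ "l + 1"], auto)
          ultimately show ?thesis by (intro common UnI2)
        next
          case False
          then have "supports \<tau> X (sV j)" using kl l' by auto
          then show ?thesis by (intro common[of "sV j"]) simp_all
        qed
      next
        case False
        then show ?thesis using p q common by blast
      qed
    qed
  qed
qed

section \<open>Failure in an infinite frame\<close>

lemma refuting_map_supported:
  assumes "plane_tiling T \<tau>"
  shows "refuting_map (medvedev_frame UNIV) (tiling_poset (tiles_at \<tau>))
    (tiling_domain (tiles_at \<tau>)) UNIV (supported \<tau>)"
  unfolding refuting_map_def
proof (intro conjI allI impI ballI)
  show "supported \<tau> UNIV = Field (tiling_poset (tiles_at \<tau>))"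
    by (simp add: supported_UNIV Field_tiling_poset)
  fix X :: "(int + int) set"
  assume "(UNIV, X) \<in> medvedev_frame UNIV"
  then show "supported \<tau> X \<noteq> {}" by (auto simp: medvedev_frame_def supported_nonempty)
  show "supported \<tau> X \<in> Up (tiling_poset (tiles_at \<tau>))" by (rule supported_Up)
  show "supported \<tau> Y \<subseteq> supported \<tau> X" if "(X, Y) \<in> medvedev_frame UNIV" for Y
    using that by (auto simp: medvedev_frame_def supported_def intro: supports_mono)
  show "\<exists>Y. (X, Y) \<in> medvedev_frame UNIV \<and> supported \<tau> Y = tiling_poset (tiles_at \<tau>) `` {p}"
    if "p \<in> supported \<tau> X" for p
  proof -
    have "p \<in> points (tiles_at \<tau>)" "supports \<tau> X p" using that by (auto simp: supported_def)
    from exists_minimal_support[OF this] obtain Y where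
      "Y \<subseteq> X" "Y \<noteq> {}" "supported \<tau> Y = tiling_poset (tiles_at \<tau>) `` {p}" by blast
    then show ?thesis by (intro exI[of _ Y]) (auto simp: medvedev_frame_def)
  qed
  show "supported \<tau> X \<subseteq> a \<or> supported \<tau> X \<subseteq> b"
    if "(a, b) \<in> tiling_domain (tiles_at \<tau>)" "supported \<tau> X \<subseteq> a \<union> b" for a b
    using supported_domain[OF assms that] .
qed

lemma finite_tiles_at:
  assumes "plane_tiling T \<tau>" "finite T"
  shows "finite (tiles_at \<tau> i j)"
  by (rule finite_subset[OF _ assms(2)]) (use assms(1) in \<open>auto simp: tiles_at_def plane_tiling_def\<close>)

lemma tiling_formula_notin_Skvortsov_logic:
  assumes \<tau>: "plane_tiling T \<tau>" and T: "finite T"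
  shows "tiling_formula (tiles_at \<tau>) \<notin> Skvortsov_logic TYPE('a::infinite)"
proof
  assume "tiling_formula (tiles_at \<tau>) \<in> Skvortsov_logic TYPE('a)"
  then have valid: "valid (medvedev_frame I) (tiling_formula (tiles_at \<tau>))" for I :: "'a set"
    by (simp add: Skvortsov_logic_def)
  \<comment> \<open>An infinite type contains a copy of \<open>nat\<close>, and hence of the
    countable type \<open>int + int\<close>.\<close>
  obtain f :: "nat \<Rightarrow> 'a" where "inj f"
    using infinite_countable_subset[OF infinite_UNIV] by blast
  then have e: "inj (f \<circ> (to_nat :: int + int \<Rightarrow> nat))" (is "inj ?e")
    by (simp add: inj_compose)
  note g = refuting_map_medvedev_frame_embed[OF refuting_map_supported[OF \<tau>] e]
  have "range ?e \<in> Field (medvedev_frame (range ?e))" by (simp add: Field_medvedev_frame)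
  moreover have "(range ?e, X) \<in> medvedev_frame (range ?e)"
    if "X \<in> Field (medvedev_frame (range ?e))" for X
    using that by (auto simp: Field_medvedev_frame) (auto simp: medvedev_frame_def)
  moreover have "finite (Field (tiling_poset (tiles_at \<tau>)))"
    by (simp add: Field_tiling_poset finite_points finite_tiles_at[OF \<tau> T])
  moreover have "root (tiling_poset (tiles_at \<tau>)) \<in> Field (tiling_poset (tiles_at \<tau>))"
    "x \<in> Field (tiling_poset (tiles_at \<tau>)) \<Longrightarrow>
      (root (tiling_poset (tiles_at \<tau>)), x) \<in> tiling_poset (tiles_at \<tau>)" for x
    by (simp_all add: root_tiling_poset Field_tiling_poset tiling_poset_iff)
  ultimately have "\<not> valid (medvedev_frame (range ?e)) (tiling_formula (tiles_at \<tau>))"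
    unfolding tiling_formula_def
    by (intro not_valid_if_refuting_map[OF Partial_order_tiling_poset _ tiling_domain_subset _ _
        Partial_order_medvedev_frame _ _ g]) blast+
  then show False using valid by blast
qed

theorem theorem1p11:
  "Skvortsov_logic TYPE('a::infinite) \<subset> Medvedev_logic TYPE('a) \<and>
   (\<exists>W :: bool \<Rightarrow> bool \<Rightarrow> tile set.
      (\<forall>i j. finite (W i j)) \<and>
      aperiodic (\<Union>i j. W i j) \<and>
      tiling_formula W \<in> Medvedev_logic TYPE('a) - Skvortsov_logic TYPE('a))"
proof -
  obtain T \<tau> where T: "finite T" "plane_tiling T \<tau>" "\<And>m n \<sigma>. \<not> periodic_tiling T m n \<sigma>"
    using exists_aperiodic unfolding aperiodic_def by blast
  \<comment> \<open>Passing from \<open>T\<close> to the tiles that occur in \<open>\<tau>\<close>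
    keeps the plane tiling and creates no periodic one.\<close>
  let ?W = "tiles_at \<tau>"
  have tiles: "(\<Union>i j. ?W i j) = range (case_prod \<tau>)" by (auto simp: tiles_at_def)
  have "plane_tiling (\<Union>i j. ?W i j) \<tau>"
    using T(2) unfolding tiles by (auto simp: plane_tiling_def)
  moreover have "(\<Union>i j. ?W i j) \<subseteq> T"
    using T(2) unfolding tiles by (auto simp: plane_tiling_def)
  then have np: "\<not> periodic_tiling (\<Union>i j. ?W i j) m n \<sigma>" for m n \<sigma>
    using T(3)[of m n \<sigma>] unfolding periodic_tiling_def by (meson subsetD)
  ultimately have "aperiodic (\<Union>i j. ?W i j)" unfolding aperiodic_def by blast
  moreover have fin: "finite (?W i j)" for i j by (rule finite_tiles_at[OF T(2,1)])
  moreover have "tiling_formula ?W \<in> Medvedev_logic TYPE('a) - Skvortsov_logic TYPE('a)"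
    using tiling_formula_in_Medvedev_logic[OF fin np]
      tiling_formula_notin_Skvortsov_logic[OF T(2,1)] by blast
  moreover have "Skvortsov_logic TYPE('a) \<subseteq> Medvedev_logic TYPE('a)"
    by (auto simp: Skvortsov_logic_def Medvedev_logic_def)
  ultimately show ?thesis by blast
qed

end
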